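(* Let $s>0$, $\lambda>0$ and $K\ge 1$. Let $\rho$ be a distortion measure on a measurable space $E$ such that $w:=\sup_{x,y\in E}\rho(x,y)<\infty$ and such that the upper box dimension $$\gamma:=\limsup_{\varepsilon\to 0}\frac{\log N(E,\rho,\varepsilon)}{\log(1/\varepsilon)}$$ is finite. Let $X$ be a $\mathbf D([0,1),E)$-valued random element whose number of jumps $N_X$ satisfies $\mathbb P(N_X=k)\le \frac{\lambda^k}{k!}e^{-\lambda}K$ for all integers $k\ge 0$. Then, as $r\to\infty$, $$-\log D^{(q)}(r\,|\,X,\rho_{\mathbf D},s)\ \gtrsim\ \sqrt{\frac{2}{s(1+\gamma)}\,r\log r},$$ i.e. $\liminf_{r\to\infty}\big(-\log D^{(q)}(r\,|\,X,\rho_{\mathbf D},s)\big)\big/\sqrt{\tfrac{2}{s(1+\gamma)}r\log r}\ge 1$.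
   Context: A distortion measure on a measurable space $E$ is a measurable symmetric function $\rho:E\times E\to[0,\infty)$ with $\rho(x,y)=0$ iff $x=y$. The covering number $N(E,\rho,\varepsilon)$ is the smallest $n\in\mathbb N$ such that there exist $x_1,\dots,x_n\in E$ with: for every $x\in E$ there is $i$ with $\rho(x,x_i)\le\varepsilon$. $\mathbf D([0,1),E)$ is the space of functions $f:[0,1)\to E$ that are piecewise constant with finitely many jumps, where a jump at $t$ from value $a$ to value $b$ means $f(t)=b$; it carries the $\sigma$-field generated by the projections $f\mapsto f(t)$. On it one uses the distortion $\rho_{\mathbf D}(f,g)=\int_0^1\rho(f(t),g(t))\,dt$. $N_X$ denotes the (random) number of jumps of $X$. For a random variable $X$ in a space with distortion $\rho$, the quantization error is $$D^{(q)}(r\,|\,X,\rho,s)=\inf\Big\{\big(\mathbb E\min_{a\in\mathcal C}\rho(X,a)^s\big)^{1/s}:\ \mathcal C\text{ a set of points with }\log\#\mathcal C\le r\Big\},$$ with natural logarithms throughout. *)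

theory Defs
  imports "HOL-Probability.Probability"
begin

definition distortion_measure :: "'e measure \<Rightarrow> ('e \<Rightarrow> 'e \<Rightarrow> real) \<Rightarrow> bool" where
  "distortion_measure ME \<rho> \<longleftrightarrow>
     (\<lambda>(x, y). \<rho> x y) \<in> borel_measurable (ME \<Otimes>\<^sub>M ME) \<and>
     (\<forall>x\<in>space ME. \<forall>y\<in>space ME. \<rho> x y = \<rho> y x) \<and>
     (\<forall>x\<in>space ME. \<forall>y\<in>space ME. 0 \<le> \<rho> x y) \<and>
     (\<forall>x\<in>space ME. \<forall>y\<in>space ME. \<rho> x y = 0 \<longleftrightarrow> x = y)"

text \<open>Covering number (infinite if no finite cover exists).\<close>
definition covering_number :: "'e set \<Rightarrow> ('e \<Rightarrow> 'e \<Rightarrow> real) \<Rightarrow> real \<Rightarrow> enat" where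
  "covering_number E \<rho> \<epsilon> =
     (INF C \<in> {C. finite C \<and> C \<subseteq> E \<and> (\<forall>x\<in>E. \<exists>c\<in>C. \<rho> x c \<le> \<epsilon>)}. enat (card C))"

definition ln_enat :: "enat \<Rightarrow> ereal" where
  "ln_enat n = (case n of enat m \<Rightarrow> ereal (ln (real m)) | \<infinity> \<Rightarrow> \<infinity>)"

definition upper_box_dim :: "'e set \<Rightarrow> ('e \<Rightarrow> 'e \<Rightarrow> real) \<Rightarrow> ereal" where
  "upper_box_dim E \<rho> =
     Limsup (at_right 0) (\<lambda>\<epsilon>. ln_enat (covering_number E \<rho> \<epsilon>) / ereal (ln (1 / \<epsilon>)))"

text \<open>The space D([0,1),E): functions on [0,1) (extensional), with values in E,
  piecewise constant with finitely many jumps, right-continuous at jumps.\<close>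
definition Dset :: "'e set \<Rightarrow> (real \<Rightarrow> 'e) set" where
  "Dset E = {f. f \<in> extensional {0..<1} \<and> f ` {0..<1} \<subseteq> E \<and>
     (\<exists>J. finite J \<and> J \<subseteq> {0<..<1} \<and>
        (\<forall>s t. 0 \<le> s \<and> s \<le> t \<and> t < 1 \<and> {s<..t} \<inter> J = {} \<longrightarrow> f s = f t))}"

definition Dspace :: "'e measure \<Rightarrow> (real \<Rightarrow> 'e) measure" where
  "Dspace ME = sigma (Dset (space ME))
     {{f \<in> Dset (space ME). f t \<in> A} | t A. t \<in> {0..<1} \<and> A \<in> sets ME}"

text \<open>Jump times: points t in (0,1) at which f differs from its left limit.\<close>
definition jumps :: "(real \<Rightarrow> 'e) \<Rightarrow> real set" where
  "jumps f = {t \<in> {0<..<1}. \<forall>\<delta>>0. \<exists>u\<in>{t - \<delta><..<t}. f u \<noteq> f t}"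

definition num_jumps :: "(real \<Rightarrow> 'e) \<Rightarrow> nat" where
  "num_jumps f = card (jumps f)"

definition rhoD :: "('e \<Rightarrow> 'e \<Rightarrow> real) \<Rightarrow> (real \<Rightarrow> 'e) \<Rightarrow> (real \<Rightarrow> 'e) \<Rightarrow> real" where
  "rhoD \<rho> f g = set_lebesgue_integral lborel {0..<1} (\<lambda>t. \<rho> (f t) (g t))"

definition quant_err :: "'w measure \<Rightarrow> ('w \<Rightarrow> 'x) \<Rightarrow> 'x set \<Rightarrow> ('x \<Rightarrow> 'x \<Rightarrow> real)
                           \<Rightarrow> real \<Rightarrow> real \<Rightarrow> real" where
  "quant_err P X S d s r =
     Inf {(enn2real (\<integral>\<^sup>+\<omega>. ennreal ((Min ((\<lambda>a. d (X \<omega>) a) ` C)) powr s) \<partial>P)) powr (1 / s) | C.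
            finite C \<and> C \<noteq> {} \<and> C \<subseteq> S \<and> ln (real (card C)) \<le> r}"

definition neg_log :: "real \<Rightarrow> ereal" where
  "neg_log x = (if x = 0 then \<infinity> else ereal (- ln x))"

end

theory Submission
  imports Defs "HOL-Real_Asymp.Real_Asymp"
begin

text \<open>
  A path with \<open>k\<close> jumps is quantized to precision \<open>\<delta>\<close> by moving its jumps to a grid of mesh about
  \<open>\<delta> / k\<close> and its values to a \<open>\<delta>\<close>-net of \<open>E\<close>; this costs about \<open>(1 + \<gamma>) k ln (1 / \<delta>)\<close> nats.
  Since \<open>P (N = k)\<close> is roughly \<open>exp (- k ln k)\<close>, the target \<open>E (error powr s) \<approx> exp (- L)\<close> allows the
  precision \<open>\<delta>\<^sub>k = exp (- (L - k ln k) / s)\<close> on \<open>{N = k}\<close>, and paths with more than \<open>2 L / ln L\<close> jumps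
  can be neglected. The cost \<open>(1 + \<gamma>) k (L - k ln k) / s\<close> is maximal near \<open>k ln k = L / 2\<close>, where it is
  about \<open>(1 + \<gamma>) L\<^sup>2 / (4 s ln L)\<close>; equating this to \<open>r\<close> gives
  \<open>L / s \<approx> sqrt (2 r ln r / (s (1 + \<gamma>)))\<close>.
\<close>

section \<open>Jumps of step functions\<close>

lemma jumps_witness:
  assumes "t \<in> jumps f" "b < t"
  obtains u where "b < u" "u < t" "f u \<noteq> f t"
proof -
  have "\<forall>\<delta>>0. \<exists>u\<in>{t - \<delta><..<t}. f u \<noteq> f t" using assms(1) by (simp add: jumps_def)
  then have "\<exists>u\<in>{t - (t - b)<..<t}. f u \<noteq> f t" using assms(2) by (elim allE[of _ "t - b"]) simp
  with that show ?thesis by auto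
qed

text \<open>If \<open>t\<close> is outside \<open>J\<close>, then \<open>f\<close> agrees with
  \<open>f t\<close> strictly between the last breakpoint before \<open>t\<close> (or 0) and
  \<open>t\<close>, which leaves no witness for a jump at \<open>t\<close>.\<close>

lemma jumps_subset_of_breakpoints:
  assumes "finite J"
    and J: "\<And>s t. 0 \<le> s \<Longrightarrow> s \<le> t \<Longrightarrow> t < 1 \<Longrightarrow> {s<..t} \<inter> J = {} \<Longrightarrow> f s = f t"
  shows "jumps f \<subseteq> J"
proof
  fix t assume t: "t \<in> jumps f"
  show "t \<in> J"
  proof (rule ccontr)
    assume nt: "t \<notin> J"
    have t01: "0 < t" "t < 1" using t by (auto simp: jumps_def)
    define S where "S = insert 0 (J \<inter> {..<t})"
    have fin: "finite S" and ne: "S \<noteq> {}" using \<open>finite J\<close> by (auto simp: S_def)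
    define b where "b = Max S"
    have b: "b \<ge> 0" "b < t" "\<And>j. j \<in> S \<Longrightarrow> j \<le> b"
      using fin ne t01 by (auto simp: b_def S_def)
    obtain u where u: "b < u" "u < t" "f u \<noteq> f t"
      using jumps_witness[OF t b(2)] .
    have "{u<..t} \<inter> J = {}"
    proof (rule ccontr)
      assume "{u<..t} \<inter> J \<noteq> {}"
      then obtain j where j: "u < j" "j \<le> t" "j \<in> J" by auto
      with nt have "j \<in> S" by (cases "j = t") (auto simp: S_def)
      with b(3)[of j] j u show False by auto
    qed
    with J[of u t] u b t01 show False by auto
  qed
qed

text \<open>Finiteness makes \<open>num_jumps\<close> a true count: on an infinite set
  \<open>card\<close> would return its default 0.\<close>

lemma finite_jumps:
  assumes "f \<in> Dset E" shows "finite (jumps f)"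
proof -
  from assms obtain J where fin: "finite J"
    and J: "\<And>s t. 0 \<le> s \<Longrightarrow> s \<le> t \<Longrightarrow> t < 1 \<Longrightarrow> {s<..t} \<inter> J = {} \<Longrightarrow> f s = f t"
    unfolding Dset_def by blast
  show ?thesis by (rule finite_subset[OF jumps_subset_of_breakpoints[OF fin J] fin])
qed

text \<open>A breakpoint need not be a jump. Induction on the number of breakpoints in the interval
  removes the last one: as it is not a jump, \<open>f\<close> already takes the same value slightly
  to its left.\<close>

lemma Dset_const_without_jumps:
  assumes f: "f \<in> Dset E" and "0 \<le> s" "s \<le> t" "t < 1" "{s<..t} \<inter> jumps f = {}"
  shows "f s = f t"
proof -
  from f obtain J where fin: "finite J" and
    J: "\<And>s t. 0 \<le> s \<Longrightarrow> s \<le> t \<Longrightarrow> t < 1 \<Longrightarrow> {s<..t} \<inter> J = {} \<Longrightarrow> f s = f t"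
    unfolding Dset_def by blast
  show ?thesis using assms(3-5)
  proof (induction "card ({s<..t} \<inter> J)" arbitrary: t rule: less_induct)
    case less
    show ?case
    proof (cases "{s<..t} \<inter> J = {}")
      case True
      then show ?thesis using J assms(2) less.prems by auto
    next
      case False
      define j where "j = Max ({s<..t} \<inter> J)"
      have j: "j \<in> {s<..t} \<inter> J" using False fin Max_in[of "{s<..t} \<inter> J"] by (auto simp: j_def)
      have jmax: "i \<le> j" if "i \<in> {s<..t} \<inter> J" for i using that fin by (auto simp: j_def)
      have "{j<..t} \<inter> J = {}"
      proof (rule ccontr)
        assume "{j<..t} \<inter> J \<noteq> {}"
        then obtain i where "j < i" "i \<le> t" "i \<in> J" by auto
        with jmax[of i] j show False by auto
      qed
      then have fj: "f j = f t" using J[of j t] j assms(2) less.prems by auto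
      have "j \<notin> jumps f" using less.prems j by auto
      then obtain d where d: "d > 0" "\<And>u. u \<in> {j - d<..<j} \<Longrightarrow> f u = f j"
        using j assms(2) less.prems unfolding jumps_def by auto
      \<comment> \<open>The maximum with \<open>s\<close> keeps \<open>u\<close> inside the interval
        while \<open>u\<close> is still within \<open>d\<close> of \<open>j\<close>.\<close>
      define u where "u = (max s (j - d) + j) / 2"
      have u: "s < u" "j - d < u" "u < j" using j d(1) by (auto simp: u_def)
      have "{s<..u} \<inter> J \<subseteq> {s<..t} \<inter> J" "j \<notin> {s<..u} \<inter> J" using u j by auto
      then have "{s<..u} \<inter> J \<subset> {s<..t} \<inter> J" using j by blast
      then have "card ({s<..u} \<inter> J) < card ({s<..t} \<inter> J)"
        using fin by (intro psubset_card_mono) auto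
      moreover have "{s<..u} \<subseteq> {s<..t}" using u j by auto
      then have "{s<..u} \<inter> jumps f = {}" using less.prems(3) by blast
      ultimately have "f s = f u" using less.hyps[of u] u j less.prems by auto
      with d(2)[of u] u fj show ?thesis by auto
    qed
  qed
qed

lemma Dset_value_in: "f \<in> Dset E \<Longrightarrow> 0 \<le> t \<Longrightarrow> t < 1 \<Longrightarrow> f t \<in> E"
  unfolding Dset_def by auto

section \<open>Counting jumps along finite meshes, and measurability of the count\<close>

lemma finite_separation:
  fixes S :: "real set"
  assumes "finite S"
  obtains d where "d > 0" "\<And>x y. x \<in> S \<Longrightarrow> y \<in> S \<Longrightarrow> x < y \<Longrightarrow> d \<le> y - x"
proof -
  \<comment> \<open>The extra 1 keeps the set of gaps nonempty when \<open>S\<close> has fewer than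
    two points.\<close>
  define T where "T = insert 1 ((\<lambda>(x,y). y - x) ` ((S \<times> S) \<inter> {(x,y). x < y}))"
  have "finite T" "T \<noteq> {}" using assms by (auto simp: T_def)
  then have "Min T > 0" "\<And>x y. x \<in> S \<Longrightarrow> y \<in> S \<Longrightarrow> x < y \<Longrightarrow> Min T \<le> y - x"
    by (auto simp: T_def intro!: Min_le)
  with that show ?thesis by blast
qed

text \<open>This count looks at finitely many coordinates of the path only, which is what makes it
  measurable. The last cell is left out because its right end 1 is outside the domain of
  paths.\<close>

definition mesh_changes :: "nat \<Rightarrow> (real \<Rightarrow> 'e) \<Rightarrow> nat set" where
  "mesh_changes N f = {i. Suc i < N \<and> f (real i / real N) \<noteq> f (real (Suc i) / real N)}"

text \<open>Once the mesh width is below all gaps between jumps, and between jumps and 1, every cell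
  holds at most one jump and the omitted last cell none. Sending a jump to its cell is then a
  bijection onto the changes.\<close>

lemma eventually_card_mesh_changes:
  assumes f: "f \<in> Dset E"
  shows "eventually (\<lambda>N. card (mesh_changes N f) = num_jumps f) sequentially"
proof -
  obtain d where d: "d > 0"
    "\<And>x y. x \<in> insert 1 (jumps f) \<Longrightarrow> y \<in> insert 1 (jumps f) \<Longrightarrow> x < y \<Longrightarrow> d \<le> y - x"
    using finite_separation[of "insert 1 (jumps f)"] finite_jumps[OF f] by auto
  have "eventually (\<lambda>N. 1 / real N < d) sequentially"
    using d(1) by (intro order_tendstoD[OF lim_1_over_n])
  then show ?thesis
    using eventually_gt_at_top[of 0]
  proof eventually_elim
    case (elim N)
    have N: "real N > 0" using elim by simp
    \<comment> \<open>Cells are open on the left and closed on the right, because a jump at a mesh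
      point already shows in the value there.\<close>
    define cell where "cell t = nat (\<lceil>real N * t\<rceil> - 1)" for t
    have cell: "real (cell t) < real N * t \<and> real N * t \<le> real (Suc (cell t))" if "t > 0" for t
    proof -
      have "real N * t > 0" using N that by simp
      then have "\<lceil>real N * t\<rceil> \<ge> 1" by linarith
      then show ?thesis unfolding cell_def by (simp add: of_nat_diff) linarith
    qed
    have cell_unique: "cell t = i" if "real i < real N * t" "real N * t \<le> real (Suc i)" for i t
    proof -
      have "\<lceil>real N * t\<rceil> = int i + 1" using that by (intro ceiling_unique) auto
      then show ?thesis by (simp add: cell_def)
    qed
    have in01: "0 < t" "t < 1" if "t \<in> jumps f" for t using that by (auto simp: jumps_def)
    have gap: "y - x > 1 / real N"
      if "x \<in> insert 1 (jumps f)" "y \<in> insert 1 (jumps f)" "x < y" for x y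
      using d(2)[OF that] elim by linarith
    have inj: "inj_on cell (jumps f)"
    proof (rule linorder_inj_onI)
      fix x y assume xy: "x < y" "x \<in> jumps f" "y \<in> jumps f"
      have "real N * (y - x) > 1" using gap[of x y] xy N by (simp add: field_simps)
      then have *: "real N * y > 1 + real N * x" by (simp add: algebra_simps)
      show "cell x \<noteq> cell y"
      proof
        assume "cell x = cell y"
        with cell[of x] cell[of y] in01[OF xy(2)] in01[OF xy(3)] * show False by simp
      qed
    qed auto
    have "mesh_changes N f = cell ` jumps f"
    proof (intro equalityI subsetI)
      fix i assume i: "i \<in> mesh_changes N f"
      then have i': "Suc i < N" "f (real i / real N) \<noteq> f (real (Suc i) / real N)"
        by (auto simp: mesh_changes_def)
      have "{real i / real N<..real (Suc i) / real N} \<inter> jumps f \<noteq> {}"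
        using Dset_const_without_jumps[OF f, of "real i / real N" "real (Suc i) / real N"] i' N
        by (auto simp: divide_right_mono)
      then obtain t where t: "t \<in> jumps f" "real i / real N < t" "t \<le> real (Suc i) / real N"
        by auto
      then have "cell t = i" using N by (intro cell_unique) (auto simp: field_simps)
      with t show "i \<in> cell ` jumps f" by auto
    next
      fix i assume "i \<in> cell ` jumps f"
      then obtain t where t: "t \<in> jumps f" "i = cell t" by auto
      have c: "real i < real N * t" "real N * t \<le> real (Suc i)" using cell[of t] in01[OF t(1)] t by auto
      have "real N * (1 - t) > 1" using gap[of t 1] t in01[OF t(1)] N by (simp add: field_simps)
      then have "real (Suc i) < real N" using c by (simp add: algebra_simps)
      then have Si: "Suc i < N" by simp
      have ti: "real i / real N < t" "t \<le> real (Suc i) / real N" using c N by (auto simp: field_simps)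
      have only: "t' = t" if "t' \<in> jumps f" "real i / real N < t'" "t' \<le> real (Suc i) / real N" for t'
      proof -
        have "cell t' = i" using that N by (intro cell_unique) (auto simp: field_simps)
        with inj t that show ?thesis by (auto dest: inj_onD)
      qed
      have "{t<..real (Suc i) / real N} \<inter> jumps f = {}"
      proof (rule ccontr)
        assume "{t<..real (Suc i) / real N} \<inter> jumps f \<noteq> {}"
        then obtain x where "t < x" "x \<le> real (Suc i) / real N" "x \<in> jumps f" by auto
        with only[of x] ti show False by auto
      qed
      then have r: "f t = f (real (Suc i) / real N)"
        using Si ti in01[OF t(1)] by (intro Dset_const_without_jumps[OF f]) auto
      \<comment> \<open>No other jump lies in the cell, so \<open>f u\<close> is the value at the
        left mesh point, while \<open>f t\<close> is the value at the right one.\<close>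
      obtain u where u: "real i / real N < u" "u < t" "f u \<noteq> f t"
        using jumps_witness[OF t(1) ti(1)] .
      have "{real i / real N<..u} \<inter> jumps f = {}"
      proof (rule ccontr)
        assume "{real i / real N<..u} \<inter> jumps f \<noteq> {}"
        then obtain x where "real i / real N < x" "x \<le> u" "x \<in> jumps f" by auto
        with only[of x] u ti show False by auto
      qed
      then have "f (real i / real N) = f u"
        using u in01[OF t(1)] by (intro Dset_const_without_jumps[OF f]) auto
      with r u Si show "i \<in> mesh_changes N f" by (auto simp: mesh_changes_def)
    qed
    with inj show ?case by (simp add: card_image num_jumps_def)
  qed
qed

lemma space_Dspace: "space (Dspace ME) = Dset (space ME)"
  unfolding Dspace_def by (rule space_measure_of) auto

lemma measurable_eval_Dspace:
  assumes X: "X \<in> measurable P (Dspace ME)" and t: "0 \<le> t" "t < 1"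
  shows "(\<lambda>\<omega>. X \<omega> t) \<in> measurable P ME"
proof (rule measurableI)
  have Xs: "X \<omega> \<in> Dset (space ME)" if "\<omega> \<in> space P" for \<omega>
    using measurable_space[OF X that] by (simp add: space_Dspace)
  then show "X \<omega> t \<in> space ME" if "\<omega> \<in> space P" for \<omega> using that t Dset_value_in by metis
  fix A assume A: "A \<in> sets ME"
  have "{f \<in> Dset (space ME). f t \<in> A} \<in> sets (Dspace ME)"
    unfolding Dspace_def
    by (subst sets_measure_of) (use A t in \<open>auto intro!: sigma_sets.Basic\<close>)
  from measurable_sets[OF X this]
  have "X -` {f \<in> Dset (space ME). f t \<in> A} \<inter> space P \<in> sets P" .
  also have "X -` {f \<in> Dset (space ME). f t \<in> A} \<inter> space P = (\<lambda>\<omega>. X \<omega> t) -` A \<inter> space P"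
    using Xs by auto
  finally show "(\<lambda>\<omega>. X \<omega> t) -` A \<inter> space P \<in> sets P" .
qed

text \<open>The diagonal of \<open>E\<close> is the zero set of \<open>\<rho>\<close>, hence measurable; without this the jump-count
  events might be non-measurable and have junk measure 0.\<close>

lemma measurable_num_jumps:
  assumes \<rho>: "distortion_measure ME \<rho>" and X: "X \<in> measurable P (Dspace ME)"
  shows "(\<lambda>\<omega>. num_jumps (X \<omega>)) \<in> measurable P (count_space UNIV)"
proof -
  have Xs: "X \<omega> \<in> Dset (space ME)" if "\<omega> \<in> space P" for \<omega>
    using measurable_space[OF X that] by (simp add: space_Dspace)
  have diff[measurable]: "Measurable.pred P (\<lambda>\<omega>. X \<omega> a \<noteq> X \<omega> b)" if "0 \<le> a" "a < 1" "0 \<le> b" "b < 1" for a b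
  proof -
    have "(\<lambda>\<omega>. (X \<omega> a, X \<omega> b)) \<in> measurable P (ME \<Otimes>\<^sub>M ME)"
      using measurable_eval_Dspace[OF X] that by (intro measurable_Pair) auto
    moreover have "(\<lambda>(x, y). \<rho> x y) \<in> borel_measurable (ME \<Otimes>\<^sub>M ME)"
      using \<rho> by (simp add: distortion_measure_def)
    ultimately have "(\<lambda>\<omega>. (\<lambda>(x, y). \<rho> x y) (X \<omega> a, X \<omega> b)) \<in> borel_measurable P"
      by (rule measurable_compose)
    then have [measurable]: "(\<lambda>\<omega>. \<rho> (X \<omega> a) (X \<omega> b)) \<in> borel_measurable P" by simp
    have "Measurable.pred P (\<lambda>\<omega>. \<rho> (X \<omega> a) (X \<omega> b) \<noteq> 0)" by measurable
    also have "?this \<longleftrightarrow> Measurable.pred P (\<lambda>\<omega>. X \<omega> a \<noteq> X \<omega> b)"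
      using \<rho> Xs that by (intro measurable_cong) (auto simp: distortion_measure_def Dset_value_in)
    finally show ?thesis .
  qed
  have "(\<lambda>\<omega>. real (card (mesh_changes N (X \<omega>)))) \<in> borel_measurable P" for N
  proof -
    have "real (card (mesh_changes N f)) =
        (\<Sum>i\<in>{i. Suc i < N}. indicator {g. g (real i / real N) \<noteq> g (real (Suc i) / real N)} f)"
      for f :: "real \<Rightarrow> 'a"
    proof -
      have "finite {i. Suc i < N}" by (rule finite_subset[of _ "{..<N}"]) auto
      then show ?thesis
        by (simp add: mesh_changes_def indicator_def sum.If_cases Int_def)
    qed
    moreover have "(\<lambda>\<omega>. \<Sum>i\<in>{i. Suc i < N}. indicator {g. g (real i / real N) \<noteq> g (real (Suc i) / real N)} (X \<omega>)::real)
        \<in> borel_measurable P"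
    proof (rule borel_measurable_sum)
      fix i assume "i \<in> {i. Suc i < N}"
      then have "Measurable.pred P (\<lambda>\<omega>. X \<omega> (real i / real N) \<noteq> X \<omega> (real (Suc i) / real N))"
        by (intro diff) auto
      then show "(\<lambda>\<omega>. indicator {g. g (real i / real N) \<noteq> g (real (Suc i) / real N)} (X \<omega>) :: real)
          \<in> borel_measurable P"
        unfolding indicator_def mem_Collect_eq of_bool_def by measurable
    qed
    ultimately show ?thesis by simp
  qed
  moreover have "(\<lambda>N. real (card (mesh_changes N (X \<omega>)))) \<longlonglongrightarrow> real (num_jumps (X \<omega>))"
    if "\<omega> \<in> space P" for \<omega>
    using eventually_card_mesh_changes[OF Xs[OF that]]
    by (intro tendsto_eventually) (auto elim: eventually_mono)
  ultimately have [measurable]: "(\<lambda>\<omega>. real (num_jumps (X \<omega>))) \<in> borel_measurable P"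
    by (rule borel_measurable_LIMSEQ_real[rotated])
  have "(\<lambda>\<omega>. nat \<lfloor>real (num_jumps (X \<omega>))\<rfloor>) \<in> measurable P (count_space UNIV)" by measurable
  then show ?thesis by simp
qed

section \<open>Nets and codebooks\<close>

text \<open>An infimum in \<open>enat\<close> over a nonempty family is attained, and a finite value
  rules out the empty family, whose infimum is \<infinity>.\<close>

lemma covering_number_attained:
  assumes "covering_number E \<rho> \<epsilon> = enat m"
  obtains C where "finite C" "C \<subseteq> E" "\<And>x. x \<in> E \<Longrightarrow> \<exists>c\<in>C. \<rho> x c \<le> \<epsilon>" "card C = m"
proof -
  define Cs where "Cs = {C. finite C \<and> C \<subseteq> E \<and> (\<forall>x\<in>E. \<exists>c\<in>C. \<rho> x c \<le> \<epsilon>)}"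
  have *: "Inf ((\<lambda>C. enat (card C)) ` Cs) = enat m" using assms by (simp add: covering_number_def Cs_def)
  then have "(\<lambda>C. enat (card C)) ` Cs \<noteq> {}" by (auto simp: Inf_enat_def)
  then have "Inf ((\<lambda>C. enat (card C)) ` Cs) \<in> (\<lambda>C. enat (card C)) ` Cs" by (rule wellorder_InfI[OF some_in_eq[THEN iffD2]])
  with * obtain C where "C \<in> Cs" "card C = m" by auto
  with that show ?thesis by (auto simp: Cs_def)
qed

text \<open>Logarithms of cardinalities are nonnegative, the convention \<open>ln 0 = 0\<close>
  covering the empty space, and the denominator is positive for \<epsilon> < 1.\<close>

lemma upper_box_dim_nonneg:
  assumes dim: "upper_box_dim E \<rho> = ereal \<gamma>"
  shows "\<gamma> \<ge> 0"
proof -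
  have "eventually (\<lambda>\<epsilon>. 0 \<le> ln_enat (covering_number E \<rho> \<epsilon>) / ereal (ln (1 / \<epsilon>))) (at_right 0)"
    using eventually_at_right_real[OF zero_less_one]
  proof eventually_elim
    case (elim \<epsilon>)
    have "ln (real m) \<ge> 0" for m :: nat by (cases m) auto
    then have "0 \<le> ln_enat (covering_number E \<rho> \<epsilon>)" by (auto simp: ln_enat_def split: enat.split)
    moreover have "ln (1 / \<epsilon>) > 0" using elim by simp
    ultimately show ?case by simp
  qed
  then have "0 \<le> Limsup (at_right 0) (\<lambda>\<epsilon>. ln_enat (covering_number E \<rho> \<epsilon>) / ereal (ln (1 / \<epsilon>)))"
    by (intro le_Limsup) auto
  with dim show ?thesis by (simp add: upper_box_dim_def)
qed

lemma small_nets_of_upper_box_dim: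
  fixes \<gamma> \<gamma>' :: real
  assumes dim: "upper_box_dim E \<rho> = ereal \<gamma>" and "\<gamma> < \<gamma>'" and "E \<noteq> {}"
  shows "eventually (\<lambda>\<epsilon>. \<exists>C. finite C \<and> C \<subseteq> E \<and> (\<forall>x\<in>E. \<exists>c\<in>C. \<rho> x c \<le> \<epsilon>) \<and>
            real (card C) \<le> \<epsilon> powr (- \<gamma>')) (at_right 0)"
proof -
  have "Limsup (at_right 0) (\<lambda>\<epsilon>. ln_enat (covering_number E \<rho> \<epsilon>) / ereal (ln (1 / \<epsilon>))) < ereal \<gamma>'"
    using assms by (simp add: upper_box_dim_def)
  then have "eventually (\<lambda>\<epsilon>. ln_enat (covering_number E \<rho> \<epsilon>) / ereal (ln (1 / \<epsilon>)) < ereal \<gamma>') (at_right 0)"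
    by (rule Limsup_lessD)
  moreover have "eventually (\<lambda>\<epsilon>::real. \<epsilon> \<in> {0<..<1}) (at_right 0)"
    by (rule eventually_at_right_real) simp
  ultimately show ?thesis
  proof eventually_elim
    case (elim \<epsilon>)
    have l: "ln (1 / \<epsilon>) > 0" using elim by simp
    show ?case
    proof (cases "covering_number E \<rho> \<epsilon>")
      case infinity
      with elim(1) l show ?thesis by (simp add: ln_enat_def)
    next
      case (enat m)
      obtain C where C: "finite C" "C \<subseteq> E" "\<And>x. x \<in> E \<Longrightarrow> \<exists>c\<in>C. \<rho> x c \<le> \<epsilon>" "card C = m"
        using covering_number_attained[OF enat] by blast
      with \<open>E \<noteq> {}\<close> have "m > 0" by (auto simp: card_gt_0_iff)
      have "ln (real m) / ln (1 / \<epsilon>) < \<gamma>'" using elim(1) l enat by (simp add: ln_enat_def)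
      then have "ln (real m) < \<gamma>' * ln (1 / \<epsilon>)" using l by (simp add: field_simps)
      also have "\<dots> = ln (\<epsilon> powr (- \<gamma>'))" using elim by (simp add: ln_powr ln_div)
      \<comment> \<open>Cancelling the logarithms needs \<open>m > 0\<close>; this holds because a
        cover of a nonempty space is nonempty.\<close>
      finally have "real m < \<epsilon> powr (- \<gamma>')"
        by (subst (asm) ln_less_cancel_iff) (use \<open>m > 0\<close> elim in auto)
      with C show ?thesis by (intro exI[of _ C]) auto
    qed
  qed
qed

text \<open>The value at \<open>t\<close> is indexed by the number of times
  \<open>\<tau> i / m\<close> that have passed, so the times may be unsorted or repeated and all
  functions \<tau> can enter a codebook. \<open>\<tau> i = m\<close> encodes a jump that never
  becomes visible on [0,1).\<close>

definition grid_step :: "nat \<Rightarrow> nat \<Rightarrow> (nat \<Rightarrow> nat) \<Rightarrow> (nat \<Rightarrow> 'e) \<Rightarrow> real \<Rightarrow> 'e" where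
  "grid_step m k \<tau> c = restrict (\<lambda>t. c (card {i\<in>{..<k}. real (\<tau> i) \<le> real m * t})) {0..<1}"

lemma grid_step_in_Dset:
  assumes "m > 0" and c: "\<And>j. j \<le> k \<Longrightarrow> c j \<in> E"
  shows "grid_step m k \<tau> c \<in> Dset E"
proof -
  have "card {i\<in>{..<k}. real (\<tau> i) \<le> real m * t} \<le> k" for t
    using card_mono[of "{..<k}" "{i\<in>{..<k}. real (\<tau> i) \<le> real m * t}"] by auto
  then have "grid_step m k \<tau> c ` {0..<1} \<subseteq> E" using c by (auto simp: grid_step_def)
  \<comment> \<open>Times at 0, or at 1 and beyond, are dropped from the breakpoints: no interval
    \<open>{s<..t}\<close> with \<open>0 \<le> s\<close> and \<open>t < 1\<close> contains
    them.\<close>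
  moreover have "\<exists>J. finite J \<and> J \<subseteq> {0<..<1} \<and>
        (\<forall>s t. 0 \<le> s \<and> s \<le> t \<and> t < 1 \<and> {s<..t} \<inter> J = {} \<longrightarrow> grid_step m k \<tau> c s = grid_step m k \<tau> c t)"
  proof (intro exI[of _ "(\<lambda>i. real (\<tau> i) / real m) ` {..<k} \<inter> {0<..<1}"] conjI allI impI)
    fix s t :: real
    assume st: "0 \<le> s \<and> s \<le> t \<and> t < 1 \<and> {s<..t} \<inter> ((\<lambda>i. real (\<tau> i) / real m) ` {..<k} \<inter> {0<..<1}) = {}"
    have "real (\<tau> i) \<le> real m * s \<longleftrightarrow> real (\<tau> i) \<le> real m * t" if "i < k" for i
    proof
      assume "real (\<tau> i) \<le> real m * s"
      also have "\<dots> \<le> real m * t" using st by (simp add: mult_left_mono)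
      finally show "real (\<tau> i) \<le> real m * t" .
    next
      assume *: "real (\<tau> i) \<le> real m * t"
      show "real (\<tau> i) \<le> real m * s"
      proof (rule ccontr)
        assume "\<not> real (\<tau> i) \<le> real m * s"
        with * \<open>m > 0\<close> have "s < real (\<tau> i) / real m" "real (\<tau> i) / real m \<le> t" by (auto simp: field_simps)
        moreover from this st have "0 < real (\<tau> i) / real m" "real (\<tau> i) / real m < 1" by linarith+
        ultimately have "real (\<tau> i) / real m \<in> {s<..t} \<inter> ((\<lambda>i. real (\<tau> i) / real m) ` {..<k} \<inter> {0<..<1})"
          using that by auto
        with st show False by blast
      qed
    qed
    then have "{i\<in>{..<k}. real (\<tau> i) \<le> real m * s} = {i\<in>{..<k}. real (\<tau> i) \<le> real m * t}" by auto
    with st show "grid_step m k \<tau> c s = grid_step m k \<tau> c t" by (simp add: grid_step_def)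
  qed auto
  ultimately show ?thesis by (simp add: Dset_def grid_step_def)
qed

section \<open>Distortion between paths and their grid approximations\<close>

lemma rhoD_nonneg:
  assumes "distortion_measure ME \<rho>" "f \<in> Dset (space ME)" "g \<in> Dset (space ME)"
  shows "0 \<le> rhoD \<rho> f g"
  unfolding rhoD_def set_lebesgue_integral_def
  by (rule Bochner_Integration.integral_nonneg) (use assms in \<open>auto simp: indicator_def distortion_measure_def Dset_value_in\<close>)

text \<open>Dominating by an integrable function bounds the Bochner integral even when the
  integrand is not known to be integrable, as the integral is then 0.\<close>

lemma rhoD_le_integral:
  assumes "integrable lborel h" "\<And>t. 0 \<le> h t"
    and "\<And>t. 0 \<le> t \<Longrightarrow> t < 1 \<Longrightarrow> \<rho> (f t) (g t) \<le> h t"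
  shows "rhoD \<rho> f g \<le> (\<integral>t. h t \<partial>lborel)"
  unfolding rhoD_def set_lebesgue_integral_def
  by (rule integral_mono') (use assms in \<open>auto simp: indicator_def\<close>)

text \<open>Crude bound for the paths with too many jumps, which may be sent to an arbitrary
  codeword.\<close>

lemma rhoD_le_sup:
  assumes "f \<in> Dset E" "g \<in> Dset E" "0 \<le> w" "\<And>x y. x \<in> E \<Longrightarrow> y \<in> E \<Longrightarrow> \<rho> x y \<le> w"
  shows "rhoD \<rho> f g \<le> w"
proof -
  have "rhoD \<rho> f g \<le> (\<integral>t. w * indicator {0..<1::real} t \<partial>lborel)"
    by (rule rhoD_le_integral) (use assms in \<open>auto simp: Dset_value_in\<close>)
  then show ?thesis by simp
qed

text \<open>Equal jump counts at two times mean that no jump lies between them, hence equal values.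
  Choosing one time for each attained count encodes the path as a sequence \<open>v\<close>.\<close>

lemma Dset_factors_through_jump_count:
  assumes f: "f \<in> Dset E"
  obtains v where "\<And>j. v j \<in> E" "\<And>t. 0 \<le> t \<Longrightarrow> t < 1 \<Longrightarrow> f t = v (card (jumps f \<inter> {..t}))"
proof -
  define N where "N t = card (jumps f \<inter> {..t})" for t
  have fin: "finite (jumps f)" by (rule finite_jumps[OF f])
  have eq: "f s = f t" if "0 \<le> s" "s \<le> t" "t < 1" "N s = N t" for s t
  proof -
    have "jumps f \<inter> {..s} = jumps f \<inter> {..t}"
      using that fin unfolding N_def by (intro card_subset_eq) auto
    moreover have "x \<notin> jumps f \<inter> {..s} \<and> (x \<in> jumps f \<longrightarrow> x \<in> jumps f \<inter> {..t})" if "x \<in> {s<..t}" for x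
      using that by auto
    ultimately have "{s<..t} \<inter> jumps f = {}" by blast
    with that show ?thesis by (intro Dset_const_without_jumps[OF f]) auto
  qed
  \<comment> \<open>Counts that are never attained get the time 0, so that every \<open>v j\<close>
    is a genuine point of \<open>E\<close>.\<close>
  define pt where "pt j = (if \<exists>t. 0 \<le> t \<and> t < 1 \<and> N t = j then SOME t. 0 \<le> t \<and> t < 1 \<and> N t = j else 0)" for j
  have pt: "0 \<le> pt j \<and> pt j < 1" for j
  proof (cases "\<exists>t. 0 \<le> t \<and> t < 1 \<and> N t = j")
    case True
    from someI_ex[OF this] True show ?thesis by (simp add: pt_def)
  next
    case False
    then show ?thesis unfolding pt_def by (subst if_not_P) auto
  qed
  have ptN: "N (pt (N t)) = N t" if "0 \<le> t" "t < 1" for t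
  proof -
    have "\<exists>t'. 0 \<le> t' \<and> t' < 1 \<and> N t' = N t" using that by blast
    from someI_ex[OF this] this show ?thesis by (simp add: pt_def)
  qed
  show ?thesis
  proof (rule that)
    show "f (pt j) \<in> E" for j using pt[of j] f by (auto intro: Dset_value_in)
    show "f t = f (pt (card (jumps f \<inter> {..t})))" if "0 \<le> t" "t < 1" for t
    proof -
      have "f t = f (pt (N t))"
      proof (cases "t \<le> pt (N t)")
        case True
        show ?thesis by (rule eq) (use True that pt[of "N t"] ptN[OF that] in simp_all)
      next
        case False
        have "f (pt (N t)) = f t" by (rule eq) (use False that pt[of "N t"] ptN[OF that] in simp_all)
        then show ?thesis by simp
      qed
      then show ?thesis by (simp add: N_def)
    qed
  qed
qed

text \<open>Each jump is delayed to the next grid time and each value replaced by a net point.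
  Outside the \<open>k\<close> delays, each no longer than \<open>1 / m\<close>, both paths have
  made equally many jumps and differ by at most \<epsilon>; during a delay the bound
  \<open>w\<close> is used.\<close>

lemma rhoD_grid_step_le:
  assumes f: "f \<in> Dset E" "num_jumps f = k" and "m > 0" "0 \<le> \<epsilon>" "0 \<le> w"
    and w: "\<And>x y. x \<in> E \<Longrightarrow> y \<in> E \<Longrightarrow> \<rho> x y \<le> w"
    and C: "C \<subseteq> E" "\<And>x. x \<in> E \<Longrightarrow> \<exists>c\<in>C. \<rho> x c \<le> \<epsilon>"
  obtains \<tau> c where "\<tau> \<in> {..<k} \<rightarrow>\<^sub>E {..m}" "c \<in> {..k} \<rightarrow>\<^sub>E C"
    "rhoD \<rho> f (grid_step m k \<tau> c) \<le> \<epsilon> + w * real k / real m"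
proof -
  obtain v where v: "\<And>j. v j \<in> E" "\<And>t. 0 \<le> t \<Longrightarrow> t < 1 \<Longrightarrow> f t = v (card (jumps f \<inter> {..t}))"
    using Dset_factors_through_jump_count[OF f(1)] by blast
  obtain net where net: "\<And>x. x \<in> E \<Longrightarrow> net x \<in> C \<and> \<rho> x (net x) \<le> \<epsilon>" using C(2) by metis
  \<comment> \<open>The enumeration is in no particular order, since only counts enter
    \<open>grid_step\<close>.\<close>
  obtain h where h: "bij_betw h {..<k} (jumps f)"
    using ex_bij_betw_nat_finite[OF finite_jumps[OF f(1)]] f(2) by (auto simp: num_jumps_def atLeast0LessThan)
  have h01: "0 < h i" "h i < 1" if "i < k" for i
    using bij_betwE[OF h] that by (auto simp: jumps_def)
  define \<tau> where "\<tau> = restrict (\<lambda>i. nat \<lceil>real m * h i\<rceil>) {..<k}"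
  define c where "c = restrict (\<lambda>j. net (v j)) {..k}"
  have \<tau>: "real m * h i \<le> real (\<tau> i)" "real (\<tau> i) \<le> real m * h i + 1" if "i < k" for i
  proof -
    have "real m * h i \<ge> 0" using h01[OF that] by simp
    then show "real m * h i \<le> real (\<tau> i)" "real (\<tau> i) \<le> real m * h i + 1"
      using that by (auto simp: \<tau>_def)
  qed
  define B where "B i = {h i..<real (\<tau> i) / real m}" for i
  \<comment> \<open>The indicators are added up, so overlapping delays do no harm.\<close>
  define H where "H t = \<epsilon> * indicator {0..<1} t + (\<Sum>i<k. w * indicator (B i) t)" for t :: real
  have Bint: "integrable lborel (\<lambda>t. w * indicator (B i) t :: real)"
    and Bval: "i < k \<Longrightarrow> (\<integral>t. w * indicator (B i) t \<partial>lborel) \<le> w * (1 / real m)" for i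
  proof -
    show "integrable lborel (\<lambda>t. w * indicator (B i) t :: real)"
      unfolding B_def
      by (cases "h i \<le> real (\<tau> i) / real m") (auto intro!: integrable_mult_right integrable_real_indicator)
    assume i: "i < k"
    have "real (\<tau> i) / real m \<le> (real m * h i + 1) / real m"
      using \<tau>[OF i] by (intro divide_right_mono) auto
    also have "\<dots> = h i + 1 / real m" using \<open>m > 0\<close> by (simp add: add_divide_distrib)
    finally have le: "real (\<tau> i) / real m - h i \<le> 1 / real m" by linarith
    have le': "h i \<le> real (\<tau> i) / real m"
      using \<tau>[OF i] \<open>m > 0\<close> by (simp add: pos_le_divide_eq mult.commute)
    then have "(\<integral>t. w * indicator (B i) t \<partial>lborel) = w * (real (\<tau> i) / real m - h i)"
      by (simp add: B_def)
    also have "\<dots> \<le> w * (1 / real m)" using le \<open>0 \<le> w\<close> by (intro mult_left_mono) auto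
    finally show "(\<integral>t. w * indicator (B i) t \<partial>lborel) \<le> w * (1 / real m)" .
  qed
  have bound: "\<rho> (f t) (grid_step m k \<tau> c t) \<le> H t" if t: "0 \<le> t" "t < 1" for t
  proof -
    define n where "n = card {i\<in>{..<k}. real (\<tau> i) \<le> real m * t}"
    have nk: "n \<le> k" unfolding n_def
      using card_mono[of "{..<k}" "{i\<in>{..<k}. real (\<tau> i) \<le> real m * t}"] by auto
    have g: "grid_step m k \<tau> c t = net (v n)"
    proof -
      have "grid_step m k \<tau> c t = c n" using t by (simp add: grid_step_def n_def)
      then show ?thesis using nk by (simp add: c_def)
    qed
    have gE: "net (v n) \<in> E" using net v(1) C(1) by auto
    have nonneg: "0 \<le> (\<Sum>i<k. w * indicator (B i) t)" using \<open>0 \<le> w\<close> by (intro sum_nonneg) auto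
    show ?thesis
    proof (cases "\<exists>i<k. t \<in> B i")
      case True
      then obtain i where i: "i < k" "t \<in> B i" by auto
      have "\<rho> (f t) (grid_step m k \<tau> c t) \<le> w" unfolding g using w gE Dset_value_in[OF f(1) t] by auto
      also have "w = w * indicator (B i) t" using i by simp
      also have "\<dots> \<le> (\<Sum>i<k. w * indicator (B i) t)" using \<open>0 \<le> w\<close> i by (intro member_le_sum) auto
      also have "\<dots> \<le> H t" using \<open>0 \<le> \<epsilon>\<close> by (simp add: H_def)
      finally show ?thesis .
    next
      case False
      \<comment> \<open>Outside all delays a jump has happened by time \<open>t\<close> exactly when
        its delayed copy has.\<close>
      have iff: "h i \<le> t \<longleftrightarrow> real (\<tau> i) \<le> real m * t" if "i < k" for i
      proof
        assume "h i \<le> t"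
        with False that have "real (\<tau> i) / real m \<le> t" by (force simp: B_def)
        then show "real (\<tau> i) \<le> real m * t" using \<open>m > 0\<close> by (simp add: field_simps)
      next
        assume "real (\<tau> i) \<le> real m * t"
        with \<tau>[OF that] have "real m * h i \<le> real m * t" by linarith
        then show "h i \<le> t" using \<open>m > 0\<close> by simp
      qed
      have "bij_betw h {i\<in>{..<k}. h i \<le> t} (jumps f \<inter> {..t})"
        using h unfolding bij_betw_def by (auto intro: inj_on_subset)
      then have "card (jumps f \<inter> {..t}) = card {i\<in>{..<k}. h i \<le> t}" by (simp add: bij_betw_same_card)
      also have "{i\<in>{..<k}. h i \<le> t} = {i\<in>{..<k}. real (\<tau> i) \<le> real m * t}" using iff by auto
      finally have "f t = v n" using v(2)[OF t] by (simp add: n_def)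
      then have "\<rho> (f t) (grid_step m k \<tau> c t) \<le> \<epsilon>" unfolding g using net v(1) by auto
      also have "\<epsilon> \<le> H t" using t nonneg by (simp add: H_def)
      finally show ?thesis .
    qed
  qed
  have I0: "integrable lborel (\<lambda>t. \<epsilon> * indicator {0..<1::real} t)" by simp
  have Isum: "integrable lborel (\<lambda>t. \<Sum>i<k. w * indicator (B i) t)"
    by (rule Bochner_Integration.integrable_sum) (rule Bint)
  have Hint: "integrable lborel H" unfolding H_def by (rule Bochner_Integration.integrable_add[OF I0 Isum])
  have "rhoD \<rho> f (grid_step m k \<tau> c) \<le> (\<integral>t. H t \<partial>lborel)"
  proof (rule rhoD_le_integral[OF Hint])
    show "0 \<le> H t" for t using \<open>0 \<le> w\<close> \<open>0 \<le> \<epsilon>\<close> by (auto simp: H_def intro!: add_nonneg_nonneg sum_nonneg)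
  qed (rule bound)
  also have "(\<integral>t. H t \<partial>lborel) = \<epsilon> + (\<Sum>i<k. \<integral>t. w * indicator (B i) t \<partial>lborel)"
  proof -
    have "(\<integral>t. H t \<partial>lborel) = (\<integral>t. \<epsilon> * indicator {0..<1::real} t \<partial>lborel) + (\<integral>t. (\<Sum>i<k. w * indicator (B i) t) \<partial>lborel)"
      unfolding H_def by (rule Bochner_Integration.integral_add[OF I0 Isum])
    also have "(\<integral>t. \<epsilon> * indicator {0..<1::real} t \<partial>lborel) = \<epsilon>" by simp
    also have "(\<integral>t. (\<Sum>i<k. w * indicator (B i) t) \<partial>lborel) = (\<Sum>i<k. \<integral>t. w * indicator (B i) t \<partial>lborel)"
      by (rule Bochner_Integration.integral_sum) (rule Bint)
    finally show ?thesis .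
  qed
  also have "\<dots> \<le> \<epsilon> + (\<Sum>i<k. w * (1 / real m))" using Bval by (intro add_left_mono sum_mono) auto
  finally have *: "rhoD \<rho> f (grid_step m k \<tau> c) \<le> \<epsilon> + w * real k / real m" by (simp add: mult.commute)
  have "\<tau> i \<le> m" if "i < k" for i
  proof -
    have "real m * h i \<le> real m * 1" using h01[OF that] by (intro mult_left_mono) auto
    then show ?thesis using that by (auto simp: \<tau>_def nat_le_iff ceiling_le_iff)
  qed
  then have "\<tau> \<in> {..<k} \<rightarrow>\<^sub>E {..m}" by (auto simp: \<tau>_def)
  moreover have "c \<in> {..k} \<rightarrow>\<^sub>E C" using net v(1) by (auto simp: c_def)
  ultimately show ?thesis using * by (rule that)
qed

text \<open>The codebook collects all grid paths with \<open>k\<close> grid times, each chosen among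
  \<open>m + 1\<close>, and \<open>k + 1\<close> values chosen in the net.\<close>

lemma codebook_for_num_jumps:
  assumes "0 < \<delta>" "\<delta> \<le> 1" "0 \<le> w"
    and w: "\<And>x y. x \<in> E \<Longrightarrow> y \<in> E \<Longrightarrow> \<rho> x y \<le> w"
    and C: "finite C" "C \<subseteq> E" "C \<noteq> {}" "\<And>x. x \<in> E \<Longrightarrow> \<exists>c\<in>C. \<rho> x c \<le> \<delta>"
  obtains G where "finite G" "G \<noteq> {}" "G \<subseteq> Dset E"
    "real (card G) \<le> (3 * real (k + 1) / \<delta>) ^ k * real (card C) ^ (k + 1)"
    "\<forall>f\<in>Dset E. num_jumps f = k \<longrightarrow> (\<exists>g\<in>G. rhoD \<rho> f g \<le> (1 + w) * \<delta>)"
proof -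
  \<comment> \<open>Using \<open>k + 1\<close> instead of \<open>k\<close> keeps \<open>m\<close>
    positive for \<open>k = 0\<close>, and it makes \<open>k / m\<close> at most \<delta>.\<close>
  define m where "m = nat \<lceil>real (k + 1) / \<delta>\<rceil>"
  have ge1: "real (k + 1) / \<delta> \<ge> 1" using assms by (simp add: field_simps)
  then have m: "real (k + 1) / \<delta> \<le> real m" "real m \<le> real (k + 1) / \<delta> + 1" unfolding m_def by linarith+
  then have "m > 0" using ge1 by (cases m) auto
  define I where "I = ({..<k} \<rightarrow>\<^sub>E {..m}) \<times> ({..k} \<rightarrow>\<^sub>E C)"
  define G where "G = (\<lambda>(\<tau>, c). grid_step m k \<tau> c) ` I"
  have finI: "finite I" unfolding I_def using C by (intro finite_cartesian_product finite_PiE) auto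
  have cardI: "card I = (m + 1) ^ k * card C ^ (k + 1)"
    unfolding I_def by (simp add: card_cartesian_product card_PiE)
  show ?thesis
  proof (rule that)
    show "finite G" using finI by (simp add: G_def)
    have "card I > 0" unfolding cardI using C by (simp add: card_gt_0_iff)
    then have "I \<noteq> {}" by auto
    then show "G \<noteq> {}" by (simp add: G_def)
    show "G \<subseteq> Dset E"
      unfolding G_def I_def using C \<open>m > 0\<close> by (auto intro!: grid_step_in_Dset)
    have "card G \<le> card I" unfolding G_def by (rule card_image_le[OF finI])
    then have "real (card G) \<le> real (m + 1) ^ k * real (card C) ^ (k + 1)"
      unfolding cardI by (metis of_nat_le_iff of_nat_mult of_nat_power)
    \<comment> \<open>With \<open>y = (k + 1) / \<delta>\<close>, rounding up and the extra grid
      point give \<open>m + 1 \<le> y + 2\<close>, which is at most \<open>3 * y\<close> since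
      \<open>y \<ge> 1\<close>.\<close>
    also have "real (m + 1) \<le> 3 * real (k + 1) / \<delta>"
    proof -
      have "real (m + 1) = real m + 1" by simp
      with m(2) ge1 have "real (m + 1) \<le> 3 * (real (k + 1) / \<delta>)" by linarith
      then show ?thesis by simp
    qed
    then have "real (m + 1) ^ k * real (card C) ^ (k + 1) \<le> (3 * real (k + 1) / \<delta>) ^ k * real (card C) ^ (k + 1)"
      by (intro mult_right_mono power_mono) auto
    finally show "real (card G) \<le> (3 * real (k + 1) / \<delta>) ^ k * real (card C) ^ (k + 1)" .
    show "\<forall>f\<in>Dset E. num_jumps f = k \<longrightarrow> (\<exists>g\<in>G. rhoD \<rho> f g \<le> (1 + w) * \<delta>)"
    proof (intro ballI impI)
      fix f assume f: "f \<in> Dset E" "num_jumps f = k"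
      obtain \<tau> c where tc: "\<tau> \<in> {..<k} \<rightarrow>\<^sub>E {..m}" "c \<in> {..k} \<rightarrow>\<^sub>E C"
        "rhoD \<rho> f (grid_step m k \<tau> c) \<le> \<delta> + w * real k / real m"
        by (rule rhoD_grid_step_le[OF f \<open>m > 0\<close> less_imp_le[OF assms(1)] \<open>0 \<le> w\<close> w C(2,4)])
      have "real k / real m \<le> \<delta>"
      proof -
        have "real k \<le> real (k + 1)" by simp
        also have "\<dots> \<le> \<delta> * real m" using m(1) assms(1) by (simp add: field_simps)
        finally show ?thesis using \<open>m > 0\<close> by (simp add: field_simps)
      qed
      then have "w * (real k / real m) \<le> w * \<delta>" using \<open>0 \<le> w\<close> by (rule mult_left_mono)
      with tc(3) have "rhoD \<rho> f (grid_step m k \<tau> c) \<le> (1 + w) * \<delta>" by (simp add: algebra_simps)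
      moreover have "grid_step m k \<tau> c \<in> G" unfolding G_def I_def using tc by force
      ultimately show "\<exists>g\<in>G. rhoD \<rho> f g \<le> (1 + w) * \<delta>" by blast
    qed
  qed
qed

section \<open>Moments of the quantization error and asymptotics\<close>

text \<open>The number \<open>k ^ k / fact k\<close> is a single term of the exponential series at
  \<open>k\<close>.\<close>

lemma inverse_fact_le_exp_entropy: "1 / fact k \<le> exp (real k) * exp (- (real k * ln (real k)))"
proof (cases "k = 0")
  case False
  have "real k ^ k / fact k \<le> (\<Sum>n. real k ^ n / fact n)"
    using summable_exp[of "real k"] sum_le_suminf[of "\<lambda>n. real k ^ n / fact n" "{k}"]
    by (simp add: divide_inverse mult.commute)
  also have "\<dots> = exp (real k)" by (simp add: exp_def divide_inverse mult.commute)
  finally have "real k ^ k / fact k \<le> exp (real k)" .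
  moreover have "exp (real k * ln (real k)) = real k ^ k"
    using False by (metis exp_ln exp_of_nat_mult of_nat_0_less_iff not_gr_zero)
  ultimately show ?thesis using False by (simp add: exp_minus field_simps)
qed simp

text \<open>The integrand is dominated pointwise by a function of \<open>N\<close>, which is
  integrated class by class. The factor \<open>(1/2) ^ k\<close> in \<open>weight\<close> makes the
  classes sum to \<open>2 * Q\<close>.\<close>

lemma nn_integral_Min_powr_le:
  fixes N :: "'w \<Rightarrow> nat" and F :: "nat \<Rightarrow> real"
  assumes "prob_space P" and N[measurable]: "N \<in> measurable P (count_space UNIV)"
    and C: "finite C" and "0 < s" "0 \<le> Q"
    and nonneg: "\<And>\<omega> a. \<omega> \<in> space P \<Longrightarrow> a \<in> C \<Longrightarrow> 0 \<le> d (X \<omega>) a"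
    and close: "\<And>\<omega>. \<omega> \<in> space P \<Longrightarrow> \<exists>a\<in>C. d (X \<omega>) a \<le> F (N \<omega>)"
    and weight: "\<And>k. measure P {\<omega> \<in> space P. N \<omega> = k} * F k powr s \<le> (1/2) ^ k * Q"
  shows "(\<integral>\<^sup>+\<omega>. ennreal (Min ((\<lambda>a. d (X \<omega>) a) ` C) powr s) \<partial>P) \<le> ennreal (2 * Q)"
proof -
  interpret prob_space P by fact
  have "(\<integral>\<^sup>+\<omega>. ennreal (Min ((\<lambda>a. d (X \<omega>) a) ` C) powr s) \<partial>P)
      \<le> (\<integral>\<^sup>+\<omega>. (\<Sum>k. ennreal (F k powr s) * indicator {\<omega> \<in> space P. N \<omega> = k} \<omega>) \<partial>P)"
  proof (rule nn_integral_mono)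
    fix \<omega> assume \<omega>: "\<omega> \<in> space P"
    from close[OF \<omega>] obtain a where a: "a \<in> C" "d (X \<omega>) a \<le> F (N \<omega>)" by auto
    have "Min ((\<lambda>a. d (X \<omega>) a) ` C) \<le> F (N \<omega>)"
      using a C by (intro order_trans[OF Min_le a(2)]) auto
    moreover have "0 \<le> Min ((\<lambda>a. d (X \<omega>) a) ` C)" using C a nonneg[OF \<omega>] by (subst Min_ge_iff) auto
    ultimately have "Min ((\<lambda>a. d (X \<omega>) a) ` C) powr s \<le> F (N \<omega>) powr s"
      using \<open>0 < s\<close> by (intro powr_mono2) auto
    then have "ennreal (Min ((\<lambda>a. d (X \<omega>) a) ` C) powr s) \<le> ennreal (F (N \<omega>) powr s)"
      by (rule ennreal_leI)
    also have "\<dots> = (\<Sum>k\<in>{N \<omega>}. ennreal (F k powr s) * indicator {\<omega> \<in> space P. N \<omega> = k} \<omega>)"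
      using \<omega> by simp
    also have "\<dots> \<le> (\<Sum>k. ennreal (F k powr s) * indicator {\<omega> \<in> space P. N \<omega> = k} \<omega>)"
      by (intro sum_le_suminf) auto
    finally show "ennreal (Min ((\<lambda>a. d (X \<omega>) a) ` C) powr s) \<le> \<dots>" .
  qed
  also have "\<dots> = (\<Sum>k. ennreal (F k powr s) * emeasure P {\<omega> \<in> space P. N \<omega> = k})"
    by (subst nn_integral_suminf) (auto simp: nn_integral_cmult_indicator)
  also have "\<dots> \<le> (\<Sum>k. ennreal ((1/2) ^ k * Q))"
  proof (intro suminf_le)
    fix k
    have "ennreal (F k powr s) * emeasure P {\<omega> \<in> space P. N \<omega> = k}
        = ennreal (measure P {\<omega> \<in> space P. N \<omega> = k} * F k powr s)"
      by (simp add: emeasure_eq_measure ennreal_mult' mult.commute)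
    also have "\<dots> \<le> ennreal ((1/2) ^ k * Q)" using weight by (rule ennreal_leI)
    finally show "ennreal (F k powr s) * emeasure P {\<omega> \<in> space P. N \<omega> = k} \<le> ennreal ((1/2) ^ k * Q)" .
  qed auto
  also have "\<dots> = ennreal (2 * Q)"
  proof (rule suminf_ennreal_eq)
    show "(\<lambda>k. (1/2) ^ k * Q) sums (2 * Q)"
      using sums_mult2[OF geometric_sums[of "1/2::real"], of Q] by simp
  qed (use \<open>0 \<le> Q\<close> in simp)
  finally show ?thesis .
qed

text \<open>One-point codebooks are admissible for \<open>0 \<le> r\<close>, so the infimum is over
  a nonempty set and not an unspecified value.\<close>

lemma quant_err_nonneg:
  assumes "S \<noteq> {}" "0 \<le> r"
  shows "0 \<le> quant_err P X S d s r"
proof -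
  obtain a where "a \<in> S" using assms by auto
  then have "\<exists>C. finite C \<and> C \<noteq> {} \<and> C \<subseteq> S \<and> ln (real (card C)) \<le> r"
    using assms(2) by (intro exI[of _ "{a}"]) auto
  then show ?thesis unfolding quant_err_def by (intro cInf_greatest) auto
qed

lemma quant_err_le:
  assumes "finite C" "C \<noteq> {}" "C \<subseteq> S" "ln (real (card C)) \<le> r" "0 < s"
    and le: "(\<integral>\<^sup>+\<omega>. ennreal (Min ((\<lambda>a. d (X \<omega>) a) ` C) powr s) \<partial>P) \<le> ennreal (exp (- (s * x)))"
  shows "quant_err P X S d s r \<le> exp (- x)"
proof -
  have "quant_err P X S d s r \<le>
      (enn2real (\<integral>\<^sup>+\<omega>. ennreal (Min ((\<lambda>a. d (X \<omega>) a) ` C) powr s) \<partial>P)) powr (1 / s)"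
    unfolding quant_err_def using assms by (intro cInf_lower bdd_belowI[of _ 0]) auto
  also have "\<dots> \<le> exp (- (s * x)) powr (1 / s)"
    using enn2real_mono[OF le] \<open>0 < s\<close> by (intro powr_mono2) auto
  also have "\<dots> = exp (- x)" using \<open>0 < s\<close> by (simp add: powr_def)
  finally show ?thesis .
qed

section \<open>Asymptotics of the coding rate\<close>

lemma parabola_le:
  fixes a x L :: real
  assumes "a > 0" shows "x * (L - a * x) \<le> L\<^sup>2 / (4 * a)"
proof -
  \<comment> \<open>The square vanishes at the maximizer \<open>x = L / (2 * a)\<close>.\<close>
  have "0 \<le> (L - 2 * a * x)\<^sup>2" by simp
  then show ?thesis using assms by (simp add: field_simps power2_eq_square)
qed

text \<open>For \<open>k\<close> up to \<open>L powr (1 - \<eta>)\<close> the crude bound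
  \<open>k * L\<close> is of smaller order than the right side. For larger \<open>k\<close>,
  \<open>ln k\<close> is at least \<open>(1 - \<eta>) * ln L\<close>, and a parabola in
  \<open>k\<close> remains.\<close>

lemma eventually_entropy_parabola_le:
  fixes \<eta> :: real
  assumes "0 < \<eta>" "\<eta> < 1"
  shows "eventually (\<lambda>L. \<forall>k::nat. real k * max 0 (L - real k * ln (real k)) \<le> L\<^sup>2 / (4 * ln L) / (1 - \<eta>)) at_top"
proof -
  have 1: "eventually (\<lambda>L. L powr (1 - \<eta>) * L \<le> L\<^sup>2 / (4 * ln L) / (1 - \<eta>)) at_top"
    using assms by real_asymp
  show ?thesis using 1 eventually_gt_at_top[of 1]
  proof eventually_elim
    case (elim L)
    have lnL: "ln L > 0" using elim by simp
    show ?case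
    proof
      fix k :: nat
      show "real k * max 0 (L - real k * ln (real k)) \<le> L\<^sup>2 / (4 * ln L) / (1 - \<eta>)"
      proof (cases "real k \<le> L powr (1 - \<eta>)")
        case True
        have "real k * ln (real k) \<ge> 0" by (cases k) auto
        then have "max 0 (L - real k * ln (real k)) \<le> L" using elim by auto
        then have "real k * max 0 (L - real k * ln (real k)) \<le> L powr (1 - \<eta>) * L"
          using True by (intro mult_mono) auto
        with elim show ?thesis by linarith
      next
        case False
        have "L powr (1 - \<eta>) > 0" using elim by simp
        then have "ln (L powr (1 - \<eta>)) \<le> ln (real k)" using False by (intro ln_mono) auto
        then have ln: "ln (real k) \<ge> (1 - \<eta>) * ln L" using elim by (simp add: ln_powr)
        then have "real k * (L - real k * ln (real k)) \<le> real k * (L - ((1 - \<eta>) * ln L) * real k)"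
          by (intro mult_left_mono) (auto intro: mult_left_mono simp: mult.commute[of _ "real k"])
        also have "\<dots> \<le> L\<^sup>2 / (4 * ((1 - \<eta>) * ln L))" using assms lnL by (intro parabola_le) auto
        also have "4 * ((1 - \<eta>) * ln L) = 4 * ln L * (1 - \<eta>)" by (rule mult.left_commute[THEN trans]) (simp only: mult.commute)
        finally have "real k * (L - real k * ln (real k)) \<le> L\<^sup>2 / (4 * ln L) / (1 - \<eta>)"
          by (simp only: divide_divide_eq_left)
        moreover have "0 \<le> L\<^sup>2 / (4 * ln L) / (1 - \<eta>)" using assms lnL by simp
        ultimately show ?thesis by (simp only: max_def mult_zero_right split: if_split) simp
      qed
    qed
  qed
qed

text \<open>The left side bounds the log-size of the code: the number of jump classes plus the cost
  of class \<open>k\<close>. Only \<open>k * max 0 (L - k * ln k)\<close> can reach the order of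
  \<open>L\<^sup>2 / ln L\<close>; it takes the share \<open>1 / (1 - \<eta>)\<close>. All other
  terms, including the excess of \<open>k + 1\<close> over \<open>k\<close>, are of order
  \<open>L\<close> and fit into \<open>\<eta> / (1 - \<eta>)\<close>.\<close>

lemma eventually_rate_le:
  fixes a s c0 \<eta> :: real
  assumes "a > 0" "s > 0" "c0 \<ge> 0" "0 < \<eta>" "\<eta> < 1"
  shows "eventually (\<lambda>L. \<forall>k::nat. real k \<le> 2 * L / ln L + 1 \<longrightarrow>
     ln (2 * L / ln L + 2) + real (k + 1) * (a * (c0 + max 0 (L - real k * ln (real k)) / s) + ln (3 * real (k + 1)))
       \<le> a / s * ((1 + \<eta>) / (1 - \<eta>)) * (L\<^sup>2 / (4 * ln L))) at_top"
proof -
  have lower: "eventually (\<lambda>L. ln (2 * L / ln L + 2) + (2 * L / ln L + 2) * (a * c0 + ln (3 * (2 * L / ln L + 2)))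
      + a / s * L \<le> a / s * (\<eta> / (1 - \<eta>)) * (L\<^sup>2 / (4 * ln L))) at_top"
    using assms by real_asymp
  show ?thesis
    using lower eventually_entropy_parabola_le[OF assms(4,5)] eventually_gt_at_top[of 1]
  proof eventually_elim
    case (elim L)
    define x where "x = 2 * L / ln L + 2"
    have lnL: "ln L > 0" using elim by simp
    show ?case
    proof (intro allI impI)
      fix k :: nat assume k: "real k \<le> 2 * L / ln L + 1"
      define M where "M = max 0 (L - real k * ln (real k))"
      have kx: "real (k + 1) \<le> x" using k by (simp add: x_def)
      have "real k * ln (real k) \<ge> 0" by (cases k) auto
      then have M: "0 \<le> M" "M \<le> L" using elim by (auto simp: M_def)
      have "real (k + 1) * M = real k * M + M" by (simp add: algebra_simps)
      also have "\<dots> \<le> L\<^sup>2 / (4 * ln L) / (1 - \<eta>) + L" using elim(2) M by (auto simp: M_def intro!: add_mono)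
      finally have "a / s * (real (k + 1) * M) \<le> a / s * (L\<^sup>2 / (4 * ln L) / (1 - \<eta>) + L)"
        using assms by (intro mult_left_mono) auto
      moreover have "real (k + 1) * (a * c0 + ln (3 * real (k + 1))) \<le> x * (a * c0 + ln (3 * x))"
        using kx assms by (intro mult_mono add_mono) auto
      moreover have "real (k + 1) * (a * (c0 + M / s) + ln (3 * real (k + 1)))
          = a / s * (real (k + 1) * M) + real (k + 1) * (a * c0 + ln (3 * real (k + 1)))"
        by (simp add: algebra_simps add_divide_distrib)
      moreover have "a / s * (L\<^sup>2 / (4 * ln L) / (1 - \<eta>) + L) + a / s * (\<eta> / (1 - \<eta>)) * (L\<^sup>2 / (4 * ln L))
          = a / s * ((1 + \<eta>) / (1 - \<eta>)) * (L\<^sup>2 / (4 * ln L)) + a / s * L"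
      proof -
        define u where "u = 1 - \<eta>"
        define Y where "Y = L\<^sup>2 / (4 * ln L)"
        show ?thesis unfolding u_def[symmetric] Y_def[symmetric]
          by (simp only: distrib_left distrib_right add_divide_distrib times_divide_eq_left times_divide_eq_right mult_1_left mult_1_right ac_simps)
      qed
      ultimately show "ln (2 * L / ln L + 2) + real (k + 1) *
            (a * (c0 + max 0 (L - real k * ln (real k)) / s) + ln (3 * real (k + 1)))
          \<le> a / s * ((1 + \<eta>) / (1 - \<eta>)) * (L\<^sup>2 / (4 * ln L))"
        using elim(1) unfolding M_def[symmetric] x_def by linarith
    qed
  qed
qed

text \<open>As \<open>L\<close> is of order \<open>sqrt (r * ln r)\<close>, \<open>ln L\<close> is
  eventually at least \<open>ln r / 2\<close>. After cancellation the constant is at most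
  \<open>(1 + \<eta>)\<^sup>2 * (1 - \<eta>) ^ 3\<close>; the factor
  \<open>(1 - \<eta>)\<^sup>2\<close> in \<open>L\<close> is there to bring it below 1.\<close>

lemma eventually_rate_at_scale_le:
  fixes s \<gamma> \<eta> :: real
  assumes "s > 0" "\<gamma> \<ge> 0" "0 < \<eta>" "\<eta> < 1"
  defines "L \<equiv> \<lambda>r. (1 - \<eta>)\<^sup>2 * s * sqrt (2 / (s * (1 + \<gamma>)) * r * ln r)"
  shows "eventually (\<lambda>r. (1 + (\<gamma> + \<eta>)) / s * ((1 + \<eta>) / (1 - \<eta>)) * ((L r)\<^sup>2 / (4 * ln (L r))) \<le> r) at_top"
    and "filterlim L at_top at_top"
proof -
  define c where "c = 2 / (s * (1 + \<gamma>))"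
  define \<theta> where "\<theta> = (1 - \<eta>)\<^sup>2 * s"
  have c: "c > 0" and \<theta>: "\<theta> > 0" using assms by (auto simp: c_def \<theta>_def)
  have L: "L = (\<lambda>r. \<theta> * sqrt (c * r * ln r))" by (simp add: L_def c_def \<theta>_def)
  show "filterlim L at_top at_top" unfolding L using c \<theta> by real_asymp
  have "eventually (\<lambda>r. ln (\<theta> * sqrt (c * r * ln r)) \<ge> ln r / 2) at_top"
    using c \<theta> by real_asymp
  then show "eventually (\<lambda>r. (1 + (\<gamma> + \<eta>)) / s * ((1 + \<eta>) / (1 - \<eta>)) * ((L r)\<^sup>2 / (4 * ln (L r))) \<le> r) at_top"
    using eventually_gt_at_top[of 1]
  proof eventually_elim
    case (elim r)
    have lnr: "ln r > 0" using elim by simp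
    have sq: "(L r)\<^sup>2 = \<theta>\<^sup>2 * (c * r * ln r)"
      unfolding L using c elim lnr by (simp add: power_mult_distrib)
    have "(L r)\<^sup>2 / (4 * ln (L r)) \<le> \<theta>\<^sup>2 * (c * r * ln r) / (4 * (ln r / 2))"
    proof -
      have "z / (4 * y) \<le> z / (4 * (x / 2))" if "x / 2 \<le> y" "0 < x" "0 \<le> z" for x y z :: real
        using that by (intro divide_left_mono mult_pos_pos) auto
      moreover have "ln r / 2 \<le> ln (L r)" using elim by (simp add: L)
      moreover have "0 \<le> \<theta>\<^sup>2 * (c * r * ln r)" using c lnr elim by simp
      ultimately show ?thesis unfolding sq using lnr by blast
    qed
    also have "\<dots> = \<theta>\<^sup>2 * c * r / 2" using lnr by (simp add: field_simps)
    finally have "(1 + (\<gamma> + \<eta>)) / s * ((1 + \<eta>) / (1 - \<eta>)) * ((L r)\<^sup>2 / (4 * ln (L r)))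
        \<le> (1 + (\<gamma> + \<eta>)) / s * ((1 + \<eta>) / (1 - \<eta>)) * (\<theta>\<^sup>2 * c * r / 2)"
      using assms by (intro mult_left_mono) auto
    also have "\<dots> = (1 + (\<gamma> + \<eta>)) / (1 + \<gamma>) * ((1 + \<eta>) * (1 - \<eta>) ^ 3) * r"
    proof -
      define u where "u = 1 - \<eta>"
      define g where "g = 1 + \<gamma>"
      have "u > 0" "g > 0" using assms by (auto simp: u_def g_def)
      then show ?thesis using assms(1) unfolding \<theta>_def c_def u_def[symmetric] g_def[symmetric]
        by (simp add: field_simps power2_eq_square power3_eq_cube)
    qed
    also have "\<dots> \<le> 1 * r"
    proof (rule mult_right_mono)
      have "(1 + (\<gamma> + \<eta>)) / (1 + \<gamma>) \<le> 1 + \<eta>" using assms by (simp add: field_simps)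
      then have "(1 + (\<gamma> + \<eta>)) / (1 + \<gamma>) * ((1 + \<eta>) * (1 - \<eta>) ^ 3) \<le> (1 + \<eta>) * ((1 + \<eta>) * (1 - \<eta>) ^ 3)"
        using assms by (intro mult_right_mono) auto
      also have "\<dots> = (1 - \<eta>\<^sup>2)\<^sup>2 * (1 - \<eta>)" by (simp add: power2_eq_square power3_eq_cube algebra_simps)
      also have "\<dots> \<le> 1 * 1" using assms
        by (intro mult_mono power_le_one) (auto simp: power_le_one)
      finally show "(1 + (\<gamma> + \<eta>)) / (1 + \<gamma>) * ((1 + \<eta>) * (1 - \<eta>) ^ 3) \<le> 1" by simp
    qed (use elim in simp)
    finally show ?case by simp
  qed
qed

section \<open>The upper bound\<close>

text \<open>The base of the first power is at least 1, so raising its exponent to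
  \<open>k + 1\<close> merges both factors. Each unit then costs \<open>ln (1 / \<delta>)\<close>
  for a time and \<gamma>' times as much for a value.\<close>

lemma codebook_card_le_exp:
  fixes \<delta> \<gamma>' :: real
  assumes "0 < \<delta>" "\<delta> \<le> 1" "real c \<le> \<delta> powr (- \<gamma>')"
  shows "(3 * real (k + 1) / \<delta>) ^ k * real c ^ (k + 1)
    \<le> exp (real (k + 1) * ((1 + \<gamma>') * ln (1 / \<delta>) + ln (3 * real (k + 1))))"
proof -
  have "(3 * real (k + 1) / \<delta>) ^ k \<le> (3 * real (k + 1) / \<delta>) ^ (k + 1)"
    using assms by (intro power_increasing) (auto simp: field_simps)
  moreover have "real c ^ (k + 1) \<le> (\<delta> powr (- \<gamma>')) ^ (k + 1)"
    using assms by (intro power_mono) auto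
  ultimately have "(3 * real (k + 1) / \<delta>) ^ k * real c ^ (k + 1)
      \<le> (3 * real (k + 1) / \<delta>) ^ (k + 1) * (\<delta> powr (- \<gamma>')) ^ (k + 1)"
    using assms by (intro mult_mono) auto
  also have "\<dots> = (3 * real (k + 1) / \<delta> * \<delta> powr (- \<gamma>')) ^ (k + 1)" by (simp only: power_mult_distrib)
  also have "3 * real (k + 1) / \<delta> * \<delta> powr (- \<gamma>') = exp ((1 + \<gamma>') * ln (1 / \<delta>) + ln (3 * real (k + 1)))"
  proof -
    have "(1 + \<gamma>') * ln (1 / \<delta>) = ln (1 / \<delta>) + - \<gamma>' * ln \<delta>"
      using assms by (simp add: ln_div algebra_simps)
    then have "exp ((1 + \<gamma>') * ln (1 / \<delta>) + ln (3 * real (k + 1)))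
        = exp (ln (1 / \<delta>)) * exp (- \<gamma>' * ln \<delta>) * exp (ln (3 * real (k + 1)))"
      by (simp only: exp_add)
    also have "\<dots> = 1 / \<delta> * \<delta> powr (- \<gamma>') * (3 * real (k + 1))"
      using assms by (simp add: powr_def)
    finally show ?thesis by simp
  qed
  finally show ?thesis by (simp only: exp_of_nat_mult)
qed

section \<open>Balancing precision against the probability of the jump classes\<close>

lemma poisson_weight_le:
  fixes lam K :: real
  assumes "lam > 0" "K \<ge> 0" "p \<le> lam ^ k / fact k * exp (- lam) * K"
  shows "p \<le> (1/2) ^ k * K * exp (real k * ln (2 * lam * exp 1)) * exp (- (real k * ln (real k)))"
proof -
  have "p \<le> lam ^ k / fact k * exp (- lam) * K" by fact
  also have "\<dots> \<le> lam ^ k / fact k * 1 * K" using assms by (intro mult_right_mono mult_left_mono) auto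
  also have "\<dots> = lam ^ k * K * (1 / fact k)" by simp
  also have "\<dots> \<le> lam ^ k * K * (exp (real k) * exp (- (real k * ln (real k))))"
    using assms by (intro mult_left_mono inverse_fact_le_exp_entropy) auto
  \<comment> \<open>The factor \<open>(1/2) ^ k\<close> is split off for the later geometric
    summation, at the price of doubling \<open>lam\<close>.\<close>
  also have "lam ^ k * K * (exp (real k) * exp (- (real k * ln (real k))))
      = (1/2) ^ k * K * (2 * lam * exp 1) ^ k * exp (- (real k * ln (real k)))"
    by (simp add: power_mult_distrib power_divide exp_of_nat_mult[symmetric])
  also have "(2 * lam * exp 1) ^ k = exp (real k * ln (2 * lam * exp 1))"
    using assms by (subst exp_of_nat_mult) simp
  finally show ?thesis .
qed

text \<open>At \<open>k = 2 * L / ln L\<close> the product \<open>k * ln k\<close> is already about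
  \<open>2 * L\<close>; the factor 2 leaves room for the term \<open>k * b\<close>.\<close>

lemma eventually_tail_scale:
  fixes b :: real
  shows "eventually (\<lambda>L. \<forall>k::nat. 2 * L / ln L \<le> real k \<longrightarrow> L \<le> real k * (ln (real k) - b)) at_top"
proof -
  have "eventually (\<lambda>L. L \<le> 2 * L / ln L * (ln (2 * L / ln L) - b)) at_top"
    and "eventually (\<lambda>L. b \<le> ln (2 * L / ln L)) at_top"
    by real_asymp+
  then show ?thesis using eventually_gt_at_top[of 1]
  proof eventually_elim
    case (elim L)
    have pos: "0 < 2 * L / ln L" using elim by simp
    show ?case
    proof (intro allI impI)
      fix k :: nat assume k: "2 * L / ln L \<le> real k"
      have "ln (2 * L / ln L) \<le> ln (real k)" using pos k by (intro ln_mono) auto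
      then have "2 * L / ln L * (ln (2 * L / ln L) - b) \<le> real k * (ln (real k) - b)"
        using k elim by (intro mult_mono) auto
      with elim show "L \<le> real k * (ln (real k) - b)" by linarith
    qed
  qed
qed

text \<open>For \<open>k \<le> n\<close> the precision is chosen so that its power \<open>s\<close>
  times \<open>exp (- (k * ln k))\<close> is at most \<open>exp (- L)\<close>; for
  \<open>k > n\<close> the probability bound alone is that small. The remaining exponential in
  \<open>k\<close> is charged at \<open>n\<close>, with \<open>max 0\<close> because its rate may be
  negative.\<close>

lemma weighted_distortion_le:
  fixes lam K s L w \<delta>0 :: real
  assumes "s > 0" "lam > 0" "K \<ge> 0" "L \<ge> 0" "0 \<le> w" "0 < \<delta>0" "\<delta>0 \<le> 1"
    and p: "p \<le> lam ^ k / fact k * exp (- lam) * K"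
    and tail: "n < k \<Longrightarrow> L \<le> real k * (ln (real k) - ln (2 * lam * exp 1))"
  defines "F \<equiv> (1 + w) * (if k \<le> n then \<delta>0 * exp (- (max 0 (L - real k * ln (real k)) / s)) else 1)"
  shows "p * F powr s \<le> (1/2) ^ k * (K * (1 + w) powr s * exp (real n * max 0 (ln (2 * lam * exp 1))) * exp (- L))"
proof -
  define b where "b = ln (2 * lam * exp 1)"
  define e where "e = real k * ln (real k)"
  define \<Delta> where "\<Delta> = (if k \<le> n then \<delta>0 * exp (- (max 0 (L - e) / s)) else 1)"
  have F: "F powr s = (1 + w) powr s * \<Delta> powr s"
    unfolding F_def e_def[symmetric] \<Delta>_def[symmetric]
    using assms(5,6) by (intro powr_mult[THEN trans]) (auto simp: \<Delta>_def)
  have main: "exp (real k * b) * exp (- e) * \<Delta> powr s \<le> exp (real n * max 0 b) * exp (- L)"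
  proof (cases "k \<le> n")
    case True
    have "\<Delta> powr s = \<delta>0 powr s * exp (- max 0 (L - e))"
      using True assms(1,6) by (simp add: \<Delta>_def powr_mult) (simp add: powr_def)
    also have "\<dots> \<le> 1 * exp (- (L - e))"
      using assms(1,6,7) by (intro mult_mono) (auto simp: powr_le1)
    finally have "exp (- e) * \<Delta> powr s \<le> exp (- e) * exp (- (L - e))" by simp
    then have 1: "exp (- e) * \<Delta> powr s \<le> exp (- L)" by (simp add: exp_add[symmetric])
    have "real k * b \<le> real k * max 0 b" by (intro mult_left_mono) auto
    also have "\<dots> \<le> real n * max 0 b" using True by (intro mult_right_mono) auto
    finally have "real k * b \<le> real n * max 0 b" .
    then have 2: "exp (real k * b) \<le> exp (real n * max 0 b)" by simp
    show ?thesis using mult_mono[OF 2 1] by (simp add: mult.assoc)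
  next
    case False
    then have "L \<le> real k * (ln (real k) - b)" using tail by (simp add: b_def)
    then have "real k * b - e \<le> - L" by (simp add: e_def algebra_simps)
    then have "exp (real k * b) * exp (- e) \<le> exp (- L)" by (simp add: exp_add[symmetric])
    also have "\<dots> \<le> exp (real n * max 0 b) * exp (- L)" by simp
    finally show ?thesis using False by (simp add: \<Delta>_def)
  qed
  have "p * F powr s \<le> (1/2) ^ k * K * exp (real k * b) * exp (- e) * F powr s"
    using poisson_weight_le[OF assms(2,3) p] by (intro mult_right_mono) (auto simp: b_def e_def)
  also have "\<dots> = (1/2) ^ k * K * (1 + w) powr s * (exp (real k * b) * exp (- e) * \<Delta> powr s)"
    by (simp add: F)
  also have "\<dots> \<le> (1/2) ^ k * K * (1 + w) powr s * (exp (real n * max 0 b) * exp (- L))"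
    using main assms(3) by (intro mult_left_mono) auto
  finally show ?thesis by (simp add: b_def mult.assoc)
qed

text \<open>The code is the union of the codebooks for \<open>k \<le> n\<close>, with
  \<open>n\<close> about \<open>2 * L / ln L\<close>. As \<open>n\<close> is of smaller order than
  \<open>L\<close>, the constants and the factor exponential in \<open>n\<close> cost at most
  \<open>exp (\<eta> * L)\<close>.\<close>

lemma eventually_quant_err_le:
  fixes ME :: "'e measure" and \<rho> :: "'e \<Rightarrow> 'e \<Rightarrow> real"
    and P :: "'w measure" and X :: "'w \<Rightarrow> real \<Rightarrow> 'e"
    and s lam K \<gamma> \<eta> :: real
  assumes "s > 0" and "lam > 0" and "K \<ge> 1"
    and \<rho>: "distortion_measure ME \<rho>"
    and bdd: "\<exists>w. \<forall>x\<in>space ME. \<forall>y\<in>space ME. \<rho> x y \<le> w"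
    and dim: "upper_box_dim (space ME) \<rho> = ereal \<gamma>"
    and P: "prob_space P"
    and X: "X \<in> measurable P (Dspace ME)"
    and jumps_le: "\<And>k::nat. measure P {\<omega> \<in> space P. num_jumps (X \<omega>) = k}
                    \<le> lam ^ k / fact k * exp (- lam) * K"
    and \<eta>: "0 < \<eta>" "\<eta> < 1"
  shows "eventually (\<lambda>L. \<forall>r. (1 + (\<gamma> + \<eta>)) / s * ((1 + \<eta>) / (1 - \<eta>)) * (L\<^sup>2 / (4 * ln L)) \<le> r \<longrightarrow>
    quant_err P X (Dset (space ME)) (rhoD \<rho>) s r \<le> exp (- ((1 - \<eta>) * L / s))) at_top"
proof -
  define E where "E = space ME"
  define a where "a = 1 + (\<gamma> + \<eta>)"
  define b where "b = ln (2 * lam * exp 1)"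
  have Xs: "X \<omega> \<in> Dset E" if "\<omega> \<in> space P" for \<omega>
    using measurable_space[OF X that] by (simp add: space_Dspace E_def)
  obtain \<omega>0 where "\<omega>0 \<in> space P" using prob_space.not_empty[OF P] by auto
  then have E: "E \<noteq> {}" using Dset_value_in[OF Xs, of \<omega>0 0] by auto
  have "\<gamma> \<ge> 0" using upper_box_dim_nonneg[OF dim] .
  then have a: "a > 0" using \<eta> by (simp add: a_def)
  obtain w0 where w0: "\<And>x y. x \<in> E \<Longrightarrow> y \<in> E \<Longrightarrow> \<rho> x y \<le> w0" using bdd by (auto simp: E_def)
  define w where "w = max 0 w0"
  have w: "0 \<le> w" "\<And>x y. x \<in> E \<Longrightarrow> y \<in> E \<Longrightarrow> \<rho> x y \<le> w"
    using w0 by (auto simp: w_def intro: le_max_iff_disj[THEN iffD2])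
  have "eventually (\<lambda>\<epsilon>. \<exists>C. finite C \<and> C \<subseteq> E \<and> (\<forall>x\<in>E. \<exists>c\<in>C. \<rho> x c \<le> \<epsilon>) \<and>
            real (card C) \<le> \<epsilon> powr (- (\<gamma> + \<eta>))) (at_right 0)"
    using \<eta> E dim by (intro small_nets_of_upper_box_dim[of _ _ \<gamma>]) (auto simp: E_def)
  then obtain \<epsilon>0 where \<epsilon>0: "\<epsilon>0 > 0" "\<And>\<epsilon>. 0 < \<epsilon> \<Longrightarrow> \<epsilon> < \<epsilon>0 \<Longrightarrow>
      \<exists>C. finite C \<and> C \<subseteq> E \<and> (\<forall>x\<in>E. \<exists>c\<in>C. \<rho> x c \<le> \<epsilon>) \<and> real (card C) \<le> \<epsilon> powr (- (\<gamma> + \<eta>))"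
    unfolding eventually_at_right_field by blast
  \<comment> \<open>Every precision used below is at most \<delta>0, hence fine enough for the net
    bound even when \<open>k * ln k\<close> exceeds \<open>L\<close>.\<close>
  define \<delta>0 where "\<delta>0 = min 1 (\<epsilon>0 / 2)"
  have \<delta>0: "0 < \<delta>0" "\<delta>0 \<le> 1" "\<delta>0 < \<epsilon>0" using \<epsilon>0(1) by (auto simp: \<delta>0_def)
  define c0 where "c0 = ln (1 / \<delta>0)"
  have c0: "c0 \<ge> 0" using \<delta>0 by (simp add: c0_def)
  define A where "A = 2 * (K * (1 + w) powr s)"
  have A: "A > 0" using assms(3) w by (simp add: A_def)
  have ev1: "eventually (\<lambda>L. ln A + (2 * L / ln L + 1) * max 0 b \<le> \<eta> * L) at_top"
    using \<eta> by (cases "b \<le> 0") (simp add: max_def; real_asymp)+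
  note ev2 = eventually_rate_le[OF a \<open>s > 0\<close> c0 \<eta>]
  note ev3 = eventually_tail_scale[of b]
  show ?thesis using ev1 ev2 ev3 eventually_gt_at_top[of 1]
  proof eventually_elim
    case (elim L)
    define x where "x = 2 * L / ln L"
    have x: "x > 0" using elim by (simp add: x_def)
    define n where "n = nat \<lceil>x\<rceil>"
    have n: "x \<le> real n" "real n \<le> x + 1" using x unfolding n_def by linarith+
    define y where "y k = max 0 (L - real k * ln (real k)) / s" for k :: nat
    have y: "y k \<ge> 0" for k using \<open>s > 0\<close> by (simp add: y_def)
    define \<delta> where "\<delta> k = \<delta>0 * exp (- y k)" for k
    have \<delta>: "0 < \<delta> k" "\<delta> k \<le> \<delta>0" for k using \<delta>0 y[of k] by (auto simp: \<delta>_def mult_le_cancel_left1)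
    define R where "R k = real (k + 1) * (a * (c0 + y k) + ln (3 * real (k + 1)))" for k
    have "\<exists>G. finite G \<and> G \<noteq> {} \<and> G \<subseteq> Dset E \<and> real (card G) \<le> exp (R k) \<and>
        (\<forall>f\<in>Dset E. num_jumps f = k \<longrightarrow> (\<exists>g\<in>G. rhoD \<rho> f g \<le> (1 + w) * \<delta> k))" for k
    proof -
      obtain C where C: "finite C" "C \<subseteq> E" "\<And>x. x \<in> E \<Longrightarrow> \<exists>c\<in>C. \<rho> x c \<le> \<delta> k"
        "real (card C) \<le> \<delta> k powr (- (\<gamma> + \<eta>))"
        using \<epsilon>0(2)[of "\<delta> k"] \<delta>[of k] \<delta>0 by auto
      have "C \<noteq> {}" using C(3) E by auto
      have \<delta>1: "\<delta> k \<le> 1" using \<delta>[of k] \<delta>0 by linarith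
      obtain G where G: "finite G" "G \<noteq> {}" "G \<subseteq> Dset E"
        "real (card G) \<le> (3 * real (k + 1) / \<delta> k) ^ k * real (card C) ^ (k + 1)"
        "\<forall>f\<in>Dset E. num_jumps f = k \<longrightarrow> (\<exists>g\<in>G. rhoD \<rho> f g \<le> (1 + w) * \<delta> k)"
        by (rule codebook_for_num_jumps[OF \<delta>(1) \<delta>1 w C(1,2) \<open>C \<noteq> {}\<close> C(3)])
      note G(4)
      also have "(3 * real (k + 1) / \<delta> k) ^ k * real (card C) ^ (k + 1)
          \<le> exp (real (k + 1) * ((1 + (\<gamma> + \<eta>)) * ln (1 / \<delta> k) + ln (3 * real (k + 1))))"
        by (rule codebook_card_le_exp[OF \<delta>(1) \<delta>1 C(4)])
      also have "ln (1 / \<delta> k) = c0 + y k" using \<delta>0 by (simp add: \<delta>_def c0_def ln_div ln_mult)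
      finally have "real (card G) \<le> exp (R k)" by (simp only: R_def a_def)
      with G(1,2,3,5) show ?thesis by blast
    qed
    then obtain G where "\<forall>k. finite (G k) \<and> G k \<noteq> {} \<and> G k \<subseteq> Dset E \<and> real (card (G k)) \<le> exp (R k) \<and>
        (\<forall>f\<in>Dset E. num_jumps f = k \<longrightarrow> (\<exists>g\<in>G k. rhoD \<rho> f g \<le> (1 + w) * \<delta> k))"
      using choice[of "\<lambda>k G. finite G \<and> G \<noteq> {} \<and> G \<subseteq> Dset E \<and> real (card G) \<le> exp (R k) \<and>
        (\<forall>f\<in>Dset E. num_jumps f = k \<longrightarrow> (\<exists>g\<in>G. rhoD \<rho> f g \<le> (1 + w) * \<delta> k))"] by blast
    then have G: "finite (G k)" "G k \<noteq> {}" "G k \<subseteq> Dset E" "real (card (G k)) \<le> exp (R k)"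
      "f \<in> Dset E \<Longrightarrow> num_jumps f = k \<Longrightarrow> \<exists>g\<in>G k. rhoD \<rho> f g \<le> (1 + w) * \<delta> k" for k f
      by blast+
    define C where "C = (\<Union>k\<le>n. G k)"
    have C: "finite C" "C \<noteq> {}" "C \<subseteq> Dset E" using G(1,2,3) by (auto simp: C_def)
    \<comment> \<open>Beyond \<open>n\<close> any codeword serves, since \<open>1 + w\<close>
      dominates the trivial bound \<open>w\<close>.\<close>
    define F where "F k = (1 + w) * (if k \<le> n then \<delta> k else 1)" for k
    define Q where "Q = K * (1 + w) powr s * exp (real n * max 0 b) * exp (- L)"
    have "(\<integral>\<^sup>+\<omega>. ennreal (Min ((\<lambda>a. rhoD \<rho> (X \<omega>) a) ` C) powr s) \<partial>P) \<le> ennreal (2 * Q)"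
    proof (rule nn_integral_Min_powr_le[OF P measurable_num_jumps[OF \<rho> X] C(1) \<open>s > 0\<close>])
      show "0 \<le> Q" using assms(3) by (simp add: Q_def)
      show "0 \<le> rhoD \<rho> (X \<omega>) g" if "\<omega> \<in> space P" "g \<in> C" for \<omega> g
        using rhoD_nonneg[OF \<rho>, of "X \<omega>" g] Xs[OF that(1)] that(2) C(3) by (auto simp: E_def)
      show "\<exists>g\<in>C. rhoD \<rho> (X \<omega>) g \<le> F (num_jumps (X \<omega>))" if \<omega>: "\<omega> \<in> space P" for \<omega>
      proof (cases "num_jumps (X \<omega>) \<le> n")
        case True
        obtain g where "g \<in> G (num_jumps (X \<omega>))" "rhoD \<rho> (X \<omega>) g \<le> (1 + w) * \<delta> (num_jumps (X \<omega>))"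
          using G(5)[OF Xs[OF \<omega>] refl] by auto
        with True show ?thesis by (auto simp: C_def F_def)
      next
        case False
        obtain g where g: "g \<in> C" using C(2) by auto
        then have "rhoD \<rho> (X \<omega>) g \<le> w" using C(3) by (intro rhoD_le_sup[OF Xs[OF \<omega>] _ w]) auto
        with False g show ?thesis by (intro bexI[of _ g]) (auto simp: F_def)
      qed
      show "measure P {\<omega> \<in> space P. num_jumps (X \<omega>) = k} * F k powr s \<le> (1/2) ^ k * Q" for k
        unfolding Q_def F_def \<delta>_def y_def b_def
      proof (rule weighted_distortion_le[OF assms(1,2) _ _ w(1) \<delta>0(1,2) jumps_le])
        assume "n < k"
        then have "2 * L / ln L \<le> real k" using n(1) by (simp add: x_def)
        with elim(3) show "L \<le> real k * (ln (real k) - ln (2 * lam * exp 1))" by (simp add: b_def)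
      qed (use assms(3) elim in auto)
    qed
    also have "2 * Q = exp (ln A + real n * max 0 b - L)"
      using A by (simp add: Q_def A_def exp_add exp_diff exp_minus field_simps)
    also have "\<dots> \<le> exp (- (s * ((1 - \<eta>) * L / s)))"
    proof -
      have "real n * max 0 b \<le> (x + 1) * max 0 b" using n by (intro mult_right_mono) auto
      with elim(1) have "ln A + real n * max 0 b - L \<le> - ((1 - \<eta>) * L)"
        by (simp add: x_def algebra_simps)
      then show ?thesis using \<open>s > 0\<close> by simp
    qed
    finally have err: "(\<integral>\<^sup>+\<omega>. ennreal (Min ((\<lambda>a. rhoD \<rho> (X \<omega>) a) ` C) powr s) \<partial>P)
        \<le> ennreal (exp (- (s * ((1 - \<eta>) * L / s))))" by (simp add: ennreal_leI)
    show ?case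
    proof (intro allI impI)
      fix r assume r: "(1 + (\<gamma> + \<eta>)) / s * ((1 + \<eta>) / (1 - \<eta>)) * (L\<^sup>2 / (4 * ln L)) \<le> r"
      \<comment> \<open>The \<open>n + 1\<close> codebooks, at most \<open>x + 2\<close> many, get
        equal shares of the \<open>exp r\<close> codewords.\<close>
      have "exp (R k) \<le> exp r / (x + 2)" if "k \<le> n" for k
      proof -
        have "real k \<le> 2 * L / ln L + 1" using that n by (simp add: x_def)
        with elim(2) have "ln (x + 2) + R k \<le> a / s * ((1 + \<eta>) / (1 - \<eta>)) * (L\<^sup>2 / (4 * ln L))"
          unfolding x_def R_def y_def by blast
        with r have "ln (x + 2) + R k \<le> r" unfolding a_def by (rule order_trans[rotated])
        then have "exp (R k) \<le> exp (r - ln (x + 2))" by simp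
        then show ?thesis using x by (simp add: exp_diff)
      qed
      then have le: "real (card (G k)) \<le> exp r / (x + 2)" if "k \<le> n" for k
        using G(4)[of k] that by (meson order_trans)
      have "card C \<le> (\<Sum>k\<le>n. card (G k))" unfolding C_def by (rule card_UN_le) simp
      then have "real (card C) \<le> (\<Sum>k\<le>n. real (card (G k)))" by (metis of_nat_le_iff of_nat_sum)
      also have "\<dots> \<le> (\<Sum>k\<le>n. exp r / (x + 2))" using le by (intro sum_mono) auto
      also have "\<dots> = real (n + 1) / (x + 2) * exp r" by simp
      also have "\<dots> \<le> 1 * exp r" using n x by (intro mult_right_mono) auto
      finally have "real (card C) \<le> exp r" by simp
      moreover have "real (card C) > 0" using C by (simp add: card_gt_0_iff)
      ultimately have "ln (real (card C)) \<le> r" by (metis ln_exp ln_mono)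
      from quant_err_le[OF C this \<open>s > 0\<close> err]
      show "quant_err P X (Dset (space ME)) (rhoD \<rho>) s r \<le> exp (- ((1 - \<eta>) * L / s))"
        by (simp add: E_def)
    qed
  qed
qed

theorem theorem1:
  fixes ME :: "'e measure" and \<rho> :: "'e \<Rightarrow> 'e \<Rightarrow> real"
    and P :: "'w measure" and X :: "'w \<Rightarrow> real \<Rightarrow> 'e"
    and s lam K \<gamma> :: real
  assumes "s > 0" and "lam > 0" and "K \<ge> 1"
    and "distortion_measure ME \<rho>"
    and "\<exists>w. \<forall>x\<in>space ME. \<forall>y\<in>space ME. \<rho> x y \<le> w"
    and "upper_box_dim (space ME) \<rho> = ereal \<gamma>"
    and "prob_space P"
    and "X \<in> measurable P (Dspace ME)"
    and "\<And>k::nat. measure P {\<omega> \<in> space P. num_jumps (X \<omega>) = k}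
                    \<le> lam ^ k / fact k * exp (- lam) * K"
  shows "Liminf at_top (\<lambda>r. neg_log (quant_err P X (Dset (space ME)) (rhoD \<rho>) s r)
            / ereal (sqrt (2 / (s * (1 + \<gamma>)) * r * ln r))) \<ge> 1"
  unfolding le_Liminf_iff
proof (intro allI impI)
  fix z :: ereal assume "z < 1"
  define S where "S r = sqrt (2 / (s * (1 + \<gamma>)) * r * ln r)" for r
  have \<gamma>: "\<gamma> \<ge> 0" using upper_box_dim_nonneg[OF assms(6)] .
  obtain \<omega> where "\<omega> \<in> space P" using prob_space.not_empty[OF assms(7)] by auto
  then have ne: "Dset (space ME) \<noteq> {}"
    using measurable_space[OF assms(8)] by (auto simp: space_Dspace)
  \<comment> \<open>The rate loses three factors \<open>1 - \<eta>\<close>: two in the choice of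
    \<open>L\<close> and one in the error bound. A small \<eta> keeps their product above
    \<open>z\<close>.\<close>
  have "((\<lambda>\<eta>::real. ereal ((1 - \<eta>) ^ 3)) \<longlongrightarrow> ereal ((1 - 0) ^ 3)) (at_right 0)"
    by (intro tendsto_intros)
  then have "eventually (\<lambda>\<eta>. z < ereal ((1 - \<eta>) ^ 3)) (at_right 0)"
    using \<open>z < 1\<close> by (intro order_tendstoD(1)) (auto simp: one_ereal_def)
  moreover have "eventually (\<lambda>\<eta>::real. \<eta> \<in> {0<..<1}) (at_right 0)"
    by (rule eventually_at_right_real) simp
  ultimately have "eventually (\<lambda>\<eta>. z < ereal ((1 - \<eta>) ^ 3) \<and> \<eta> \<in> {0<..<1}) (at_right 0)"
    by eventually_elim auto
  then obtain \<eta> where \<eta>: "z < ereal ((1 - \<eta>) ^ 3)" "0 < \<eta>" "\<eta> < 1"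
    by (auto dest!: eventually_happens)
  define L where "L r = (1 - \<eta>)\<^sup>2 * s * sqrt (2 / (s * (1 + \<gamma>)) * r * ln r)" for r
  note scale = eventually_rate_at_scale_le[OF assms(1) \<gamma> \<eta>(2,3), folded L_def]
  have "eventually (\<lambda>r. \<forall>r'. (1 + (\<gamma> + \<eta>)) / s * ((1 + \<eta>) / (1 - \<eta>)) * ((L r)\<^sup>2 / (4 * ln (L r))) \<le> r' \<longrightarrow>
    quant_err P X (Dset (space ME)) (rhoD \<rho>) s r' \<le> exp (- ((1 - \<eta>) * L r / s))) at_top"
    using eventually_quant_err_le[OF assms \<eta>(2,3)] scale(2) by (rule eventually_compose_filterlim)
  then show "eventually (\<lambda>r. z < neg_log (quant_err P X (Dset (space ME)) (rhoD \<rho>) s r)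
            / ereal (sqrt (2 / (s * (1 + \<gamma>)) * r * ln r))) at_top"
    using scale(1) eventually_gt_at_top[of 1]
  proof eventually_elim
    case (elim r)
    define q where "q = quant_err P X (Dset (space ME)) (rhoD \<rho>) s r"
    have "q \<ge> 0" unfolding q_def using ne elim by (intro quant_err_nonneg) auto
    have "S r > 0" unfolding S_def using elim assms(1) \<gamma> by (auto intro!: mult_pos_pos divide_pos_pos)
    have "(1 - \<eta>) * L r / s = (1 - \<eta>) ^ 3 * S r"
      using assms(1) by (simp add: L_def S_def power3_eq_cube power2_eq_square)
    with elim have q: "q \<le> exp (- ((1 - \<eta>) ^ 3 * S r))" by (simp add: q_def)
    \<comment> \<open>A vanishing error is treated apart: \<open>neg_log\<close> is then
      \<infinity>, whereas \<open>ln 0\<close> is 0.\<close>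
    have "ereal ((1 - \<eta>) ^ 3 * S r) \<le> neg_log q"
    proof (cases "q = 0")
      case False
      with \<open>q \<ge> 0\<close> q have "ln q \<le> - ((1 - \<eta>) ^ 3 * S r)" by (metis ln_exp ln_mono order_le_less)
      with False show ?thesis by (simp add: neg_log_def)
    qed (simp add: neg_log_def)
    then have "ereal ((1 - \<eta>) ^ 3) \<le> neg_log q / ereal (S r)"
      using \<open>S r > 0\<close> by (subst ereal_le_divide_pos) (auto simp: mult.commute)
    with \<eta>(1) show ?case unfolding q_def S_def by (rule less_le_trans)
  qed
qed

end
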